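(* Let $G(t_1,t_2,h)$ be the number of shapes having $t_1$ interior arcs in the top row, $t_2$ interior arcs in the bottom row and $h$ exterior arcs, and let $\mathbf{G}(u,v,z)=\sum_{t_1,t_2,h\ge 0} G(t_1,t_2,h)\,u^{t_1}v^{t_2}z^h$. Then $\mathbf{G}$ satisfies $$\mathbf{A}(u,v,z)\,\mathbf{G}(u,v,z)^2+\mathbf{B}(u,v,z)\,\mathbf{G}(u,v,z)+\mathbf{C}(u,v,z)=0,$$ where $\mathbf{A}(u,v,z)=(u+v+uv)(z+1)$, $\mathbf{B}(u,v,z)=-\big((u+v+uv)(z+2)+1\big)$, $\mathbf{C}(u,v,z)=(1+u)(1+v)(1+z)$.
   Context: Joint structures. For integers $n,m\ge 0$ consider a top row of vertices $R_1,\dots,R_n$ and a bottom row $S_1,\dots,S_m$ (either row may be empty). A pre-structure is a set of arcs on these vertices, each vertex incident to at most one arc, of three kinds: interior top arcs $R_iR_j$ ($i<j$), interior bottom arcs $S_{i}S_{j}$ ($i<j$), and exterior arcs $R_kS_{k'}$. Interior arcs in each row are noncrossing (no $R_iR_j,R_kR_l$ with $i<k<j<l$, likewise in $S$), and exterior arcs are noncrossing (no two exterior arcs $R_kS_{k'},R_lS_{l'}$ with $k<l$ and $k'>l'$). An interior arc $R_iR_j$ is an ancestor of the exterior arc $R_kS_{k'}$ (which is then its descendant) if $i<k<j$; likewise $S_{i'}S_{j'}$ is an ancestor of $R_kS_{k'}$ if $i'<k'<j'$. An interior top arc and an interior bottom arc are dependent if they have a common descendant. One subsumes the other if the set of descendants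 of the other is contained in its set of descendants. A zigzag is a pair of dependent interior arcs $R_iR_j$, $S_{i'}S_{j'}$ neither of which subsumes the other. A joint structure is a zigzag-free pre-structure. An interior stack of length $\sigma$ is a maximal sequence of arcs $R_iR_j,R_{i+1}R_{j-1},\dots,R_{i+\sigma-1}R_{j-\sigma+1}$ (or the analogue in the bottom row); an exterior stack of length $\tau$ is a maximal sequence $R_iS_{i'},R_{i+1}S_{i'+1},\dots,R_{i+\tau-1}S_{i'+\tau-1}$. Shapes. A shape is a joint structure containing no secondary segments (i.e. every vertex is the endpoint of an arc and every interior arc has at least one exterior descendant; equivalently, it is what remains of a joint structure after deleting all parts containing no exterior arc endpoints, namely the pieces consisting only of unpaired vertices and interior arcs without exterior descendants) and in which every interior stack and every exterior stack has length exactly one. The empty structure is a shape. *)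

theory Defs
  imports Complex_Main "HOL-Computational_Algebra.Formal_Power_Series"
begin

datatype vertex = VR nat | VS nat

datatype arc = TopArc nat nat | BotArc nat nat | ExtArc nat nat

fun endpoints :: "arc \<Rightarrow> vertex set" where
  "endpoints (TopArc i j) = {VR i, VR j}"
| "endpoints (BotArc i j) = {VS i, VS j}"
| "endpoints (ExtArc k k') = {VR k, VS k'}"

fun is_top :: "arc \<Rightarrow> bool" where
  "is_top (TopArc i j) = True"
| "is_top (BotArc i j) = False"
| "is_top (ExtArc k k') = False"

fun is_bot :: "arc \<Rightarrow> bool" where
  "is_bot (TopArc i j) = False"
| "is_bot (BotArc i j) = True"
| "is_bot (ExtArc k k') = False"

fun is_ext :: "arc \<Rightarrow> bool" where
  "is_ext (TopArc i j) = False"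
| "is_ext (BotArc i j) = False"
| "is_ext (ExtArc k k') = True"

definition vertices :: "nat \<Rightarrow> nat \<Rightarrow> vertex set" where
  "vertices n m = VR ` {1..n} \<union> VS ` {1..m}"

definition pre_structure :: "nat \<Rightarrow> nat \<Rightarrow> arc set \<Rightarrow> bool" where
  "pre_structure n m A \<longleftrightarrow>
     (\<forall>a\<in>A. endpoints a \<subseteq> vertices n m) \<and>
     (\<forall>i j. TopArc i j \<in> A \<longrightarrow> i < j) \<and>
     (\<forall>i j. BotArc i j \<in> A \<longrightarrow> i < j) \<and>
     (\<forall>a\<in>A. \<forall>b\<in>A. endpoints a \<inter> endpoints b \<noteq> {} \<longrightarrow> a = b) \<and>
     \<not> (\<exists>i j k l. TopArc i j \<in> A \<and> TopArc k l \<in> A \<and> i < k \<and> k < j \<and> j < l) \<and>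
     \<not> (\<exists>i j k l. BotArc i j \<in> A \<and> BotArc k l \<in> A \<and> i < k \<and> k < j \<and> j < l) \<and>
     \<not> (\<exists>k k' l l'. ExtArc k k' \<in> A \<and> ExtArc l l' \<in> A \<and> k < l \<and> k' > l')"

fun ancestor :: "arc \<Rightarrow> arc \<Rightarrow> bool" where
  "ancestor (TopArc i j) (ExtArc k k') \<longleftrightarrow> i < k \<and> k < j"
| "ancestor (BotArc i j) (ExtArc k k') \<longleftrightarrow> i < k' \<and> k' < j"
| "ancestor _ _ \<longleftrightarrow> False"

definition descendants :: "arc set \<Rightarrow> arc \<Rightarrow> arc set" where
  "descendants A a = {e \<in> A. ancestor a e}"

definition dependent_arcs :: "arc set \<Rightarrow> arc \<Rightarrow> arc \<Rightarrow> bool" where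
  "dependent_arcs A a b \<longleftrightarrow> descendants A a \<inter> descendants A b \<noteq> {}"

definition subsumes :: "arc set \<Rightarrow> arc \<Rightarrow> arc \<Rightarrow> bool" where
  "subsumes A a b \<longleftrightarrow> descendants A b \<subseteq> descendants A a"

definition zigzag :: "arc set \<Rightarrow> arc \<Rightarrow> arc \<Rightarrow> bool" where
  "zigzag A a b \<longleftrightarrow> a \<in> A \<and> b \<in> A \<and> is_top a \<and> is_bot b \<and> dependent_arcs A a b \<and>
     \<not> subsumes A a b \<and> \<not> subsumes A b a"

definition joint_structure :: "nat \<Rightarrow> nat \<Rightarrow> arc set \<Rightarrow> bool" where
  "joint_structure n m A \<longleftrightarrow> pre_structure n m A \<and> \<not> (\<exists>a b. zigzag A a b)"

text \<open>
  In a pre-structure every index is at least 1, so an arc in which the subtraction below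
  truncates is never an arc of the structure.
\<close>

definition top_seq :: "nat \<Rightarrow> nat \<Rightarrow> nat \<Rightarrow> arc set" where
  "top_seq i j l = (\<lambda>s. TopArc (i + s) (j - s)) ` {..<l}"

definition bot_seq :: "nat \<Rightarrow> nat \<Rightarrow> nat \<Rightarrow> arc set" where
  "bot_seq i j l = (\<lambda>s. BotArc (i + s) (j - s)) ` {..<l}"

definition ext_seq :: "nat \<Rightarrow> nat \<Rightarrow> nat \<Rightarrow> arc set" where
  "ext_seq i i' l = (\<lambda>s. ExtArc (i + s) (i' + s)) ` {..<l}"

definition maximal_seq :: "(nat \<Rightarrow> nat \<Rightarrow> nat \<Rightarrow> arc set) \<Rightarrow> arc set \<Rightarrow> nat \<Rightarrow> nat \<Rightarrow> nat \<Rightarrow> bool" where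
  "maximal_seq seq A i j l \<longleftrightarrow> 0 < l \<and> seq i j l \<subseteq> A \<and>
     \<not> (\<exists>i' j' l'. seq i' j' l' \<subseteq> A \<and> seq i j l \<subset> seq i' j' l')"

definition interior_stack :: "arc set \<Rightarrow> nat \<Rightarrow> nat \<Rightarrow> nat \<Rightarrow> bool" where
  "interior_stack A i j l \<longleftrightarrow> maximal_seq top_seq A i j l \<or> maximal_seq bot_seq A i j l"

definition exterior_stack :: "arc set \<Rightarrow> nat \<Rightarrow> nat \<Rightarrow> nat \<Rightarrow> bool" where
  "exterior_stack A i i' l \<longleftrightarrow> maximal_seq ext_seq A i i' l"

definition no_secondary_segments :: "nat \<Rightarrow> nat \<Rightarrow> arc set \<Rightarrow> bool" where
  "no_secondary_segments n m A \<longleftrightarrow>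
     (\<forall>x\<in>vertices n m. \<exists>a\<in>A. x \<in> endpoints a) \<and>
     (\<forall>a\<in>A. is_top a \<or> is_bot a \<longrightarrow> descendants A a \<noteq> {})"

definition shape :: "nat \<Rightarrow> nat \<Rightarrow> arc set \<Rightarrow> bool" where
  "shape n m A \<longleftrightarrow> joint_structure n m A \<and> no_secondary_segments n m A \<and>
     (\<forall>i j l. interior_stack A i j l \<longrightarrow> l = 1) \<and>
     (\<forall>i i' l. exterior_stack A i i' l \<longrightarrow> l = 1)"

definition shapes :: "nat \<Rightarrow> nat \<Rightarrow> nat \<Rightarrow> (nat \<times> nat \<times> arc set) set" where
  "shapes t1 t2 h = {(n, m, A). shape n m A \<and>
     card {a \<in> A. is_top a} = t1 \<and> card {a \<in> A. is_bot a} = t2 \<and> card {a \<in> A. is_ext a} = h}"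

definition num_shapes :: "nat \<Rightarrow> nat \<Rightarrow> nat \<Rightarrow> nat" where
  "num_shapes t1 t2 h = card (shapes t1 t2 h)"

text \<open>
  Power series in \<open>u, v, z\<close> with integer coefficients are represented in the iterated ring
  \<open>\<int>[[u]][[v]][[z]]\<close>, the outermost variable being \<open>z\<close>.
\<close>

type_synonym fps3 = "int fps fps fps"

definition var_u :: fps3 where "var_u = fps_const (fps_const fps_X)"
definition var_v :: fps3 where "var_v = fps_const fps_X"
definition var_z :: fps3 where "var_z = fps_X"

definition coeff3 :: "fps3 \<Rightarrow> nat \<Rightarrow> nat \<Rightarrow> nat \<Rightarrow> int" where
  "coeff3 F a b c = fps_nth (fps_nth (fps_nth F c) b) a"

definition shape_gf :: fps3 where
  "shape_gf = Abs_fps (\<lambda>h. Abs_fps (\<lambda>t2. Abs_fps (\<lambda>t1. int (num_shapes t1 t2 h))))"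

lemma coeff3_shape_gf: "coeff3 shape_gf t1 t2 h = int (num_shapes t1 t2 h)"
  by (simp add: coeff3_def shape_gf_def)

lemma coeff3_monomial:
  "coeff3 (var_u ^ a * var_v ^ b * var_z ^ c) i j k = (if i = a \<and> j = b \<and> k = c then 1 else 0)"
proof -
  have "var_u ^ a * var_v ^ b = fps_const (fps_const (fps_X ^ a) * fps_X ^ b)"
    by (simp add: var_u_def var_v_def fps_const_power)
  then show ?thesis
    by (auto simp: coeff3_def var_z_def fps_X_power_mult_right_nth fps_X_power_nth)
qed

lemma shape_empty: "shape 0 0 {}"
  by (auto simp: shape_def joint_structure_def pre_structure_def zigzag_def
      no_secondary_segments_def vertices_def interior_stack_def exterior_stack_def
      maximal_seq_def top_seq_def bot_seq_def ext_seq_def lessThan_empty_iff)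

lemma finite_vertices: "finite (vertices n m)"
  by (simp add: vertices_def)

lemma card_vertices: "card (vertices n m) = n + m"
  unfolding vertices_def
  by (subst card_Un_disjoint) (auto simp: card_image inj_on_def)

lemma pre_structure_arcs_subset:
  assumes "pre_structure n m A" "n \<le> N" "m \<le> N"
  shows "A \<subseteq> case_prod TopArc ` ({..N} \<times> {..N}) \<union> case_prod BotArc ` ({..N} \<times> {..N}) \<union>
             case_prod ExtArc ` ({..N} \<times> {..N})" (is "_ \<subseteq> ?X")
proof
  fix a assume "a \<in> A"
  then have "endpoints a \<subseteq> vertices n m"
    using assms(1) unfolding pre_structure_def by blast
  then show "a \<in> ?X"
    using assms(2,3) by (cases a) (force simp: vertices_def image_iff)+
qed

lemma finite_pre_structure: "pre_structure n m A \<Longrightarrow> finite A"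
  by (rule finite_subset[OF pre_structure_arcs_subset[of n m A "max n m"]]) auto

lemma finite_shapes: "finite (shapes t1 t2 h)"
proof -
  define N where "N = 2 * (t1 + t2 + h)"
  define X where "X = case_prod TopArc ` ({..N} \<times> {..N}) \<union> case_prod BotArc ` ({..N} \<times> {..N}) \<union>
             case_prod ExtArc ` ({..N} \<times> {..N})"
  have "shapes t1 t2 h \<subseteq> {..N} \<times> {..N} \<times> Pow X"
  proof
    fix x assume "x \<in> shapes t1 t2 h"
    then obtain n m A where x: "x = (n, m, A)" and sh: "shape n m A"
      and c: "card {a \<in> A. is_top a} = t1" "card {a \<in> A. is_bot a} = t2"
        "card {a \<in> A. is_ext a} = h"
      unfolding shapes_def by blast
    have pre: "pre_structure n m A" and cover: "vertices n m \<subseteq> (\<Union>a\<in>A. endpoints a)"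
      using sh unfolding shape_def joint_structure_def no_secondary_segments_def by auto
    have fin: "finite A" using finite_pre_structure[OF pre] .
    have cA: "A = {a \<in> A. is_top a} \<union> ({a \<in> A. is_bot a} \<union> {a \<in> A. is_ext a})"
    proof -
      have "is_top a \<or> is_bot a \<or> is_ext a" for a by (cases a) auto
      then show ?thesis by blast
    qed
    have "card A \<le> t1 + (t2 + h)"
      by (subst cA)
        (use c in \<open>fastforce intro!: order_trans[OF card_Un_le] add_mono\<close>)
    have fe: "finite (endpoints a)" and ce: "card (endpoints a) \<le> 2" for a
      by (cases a; simp add: card_insert_if)+
    have "n + m \<le> card (\<Union>a\<in>A. endpoints a)"
      using card_mono[OF _ cover] fin fe by (simp add: card_vertices)
    also have "\<dots> \<le> (\<Sum>a\<in>A. card (endpoints a))"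
      by (rule card_UN_le[OF fin])
    also have "\<dots> \<le> (\<Sum>a\<in>A. 2)"
      by (rule sum_mono) (rule ce)
    also have "\<dots> \<le> N"
      using \<open>card A \<le> t1 + (t2 + h)\<close> by (simp add: N_def)
    finally have "n \<le> N" "m \<le> N" by auto
    with pre_structure_arcs_subset[OF pre] show "x \<in> {..N} \<times> {..N} \<times> Pow X"
      by (simp add: x X_def)
  qed
  moreover have "finite ({..N} \<times> {..N} \<times> Pow X)"
    by (simp add: X_def)
  ultimately show ?thesis by (rule finite_subset)
qed

end

theory Submission
  imports Defs "HOL-Library.Product_Lexorder"
begin

text \<open>
  Number the exterior arcs of a shape from left to right by \<open>0, \<dots>, h - 1\<close>. An interior arc covers an
  interval of them, and since there are no secondary segments and all interior stacks have length one,
  a row is determined by the set of intervals of its interior arcs, which can be any laminar set of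
  nonempty intervals. Being zigzag-free means that the union \<open>F\<close> of the two sets, of the top and of the
  bottom row, is laminar, and exterior stacks have length one iff any two consecutive exterior
  arcs are separated by an endpoint of a member of \<open>F\<close>. Each member of \<open>F\<close> comes from the top row, the
  bottom row or both, which contributes the weight \<open>w = u + v + u v\<close>, so \<open>\<^bold>G\<close> is the series of such
  families in \<open>w\<close> and \<open>z\<close>.

  Let \<open>J\<close> be the series of the families that contain the full interval. Deleting that interval gives
  \<open>J = w (\<^bold>G - 1 - J)\<close>. A nonempty family starts with at most one uncovered exterior arc, followed by a
  maximal interval with everything inside it, followed by an arbitrary family, so
  \<open>\<^bold>G = (1 + z) (1 + J \<^bold>G)\<close>. Eliminating \<open>J\<close> gives the quadratic equation.
\<close>

section \<open>Laminar families of intervals\<close>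

text \<open>A pair \<open>(a, b)\<close> stands for the interval \<open>{a..<b}\<close> of exterior arcs, numbered from \<open>0\<close>.\<close>

definition laminar :: "(nat \<times> nat) set \<Rightarrow> bool" where
  "laminar F \<longleftrightarrow> (\<forall>a b c d. (a, b) \<in> F \<longrightarrow> (c, d) \<in> F \<longrightarrow>
     b \<le> c \<or> d \<le> a \<or> (a \<le> c \<and> d \<le> b) \<or> (c \<le> a \<and> b \<le> d))"

definition intervals :: "nat \<Rightarrow> (nat \<times> nat) set" where
  "intervals h = {(a, b). a < b \<and> b \<le> h}"

definition separated :: "nat \<Rightarrow> (nat \<times> nat) set \<Rightarrow> bool" where
  "separated h F \<longleftrightarrow> (\<forall>k. 0 < k \<longrightarrow> k < h \<longrightarrow> (\<exists>x. (x, k) \<in> F \<or> (k, x) \<in> F))"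

definition families :: "nat \<Rightarrow> (nat \<times> nat) set set" where
  "families h = {F. F \<subseteq> intervals h \<and> laminar F \<and> separated h F}"

definition full_families :: "nat \<Rightarrow> (nat \<times> nat) set set" where
  "full_families h = {F \<in> families h. (0, h) \<in> F}"

definition shift :: "nat \<Rightarrow> (nat \<times> nat) set \<Rightarrow> (nat \<times> nat) set" where
  "shift k F = (\<lambda>(x, y). (x + k, y + k)) ` F"

lemma mem_shift: "(x, y) \<in> shift k F \<longleftrightarrow> k \<le> x \<and> k \<le> y \<and> (x - k, y - k) \<in> F"
  by (force simp: shift_def image_iff)

lemma finite_intervals: "finite (intervals h)"
  by (rule finite_subset[of _ "{..h} \<times> {..h}"]) (auto simp: intervals_def)

lemma finite_families: "finite (families h)"
  by (rule finite_subset[of _ "Pow (intervals h)"]) (auto simp: families_def finite_intervals)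

lemma finite_family: "F \<in> families h \<Longrightarrow> finite F"
  using finite_intervals finite_subset by (auto simp: families_def)

lemma card_shift: "card (shift k F) = card F"
  unfolding shift_def by (rule card_image) (auto simp: inj_on_def)

lemma families_intervalD: "F \<in> families h \<Longrightarrow> (a, b) \<in> F \<Longrightarrow> a < b \<and> b \<le> h"
  by (auto simp: families_def intervals_def)

lemma families_laminarD:
  "F \<in> families h \<Longrightarrow> (a, b) \<in> F \<Longrightarrow> (c, d) \<in> F \<Longrightarrow> b \<le> c \<or> d \<le> a \<or> (a \<le> c \<and> d \<le> b) \<or> (c \<le> a \<and> b \<le> d)"
  by (auto simp: families_def laminar_def)

lemma families_separatedD:
  "F \<in> families h \<Longrightarrow> 0 < k \<Longrightarrow> k < h \<Longrightarrow> \<exists>x. (x, k) \<in> F \<or> (k, x) \<in> F"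
  by (auto simp: families_def separated_def)

lemma familiesI:
  assumes "\<And>a b. (a, b) \<in> F \<Longrightarrow> a < b \<and> b \<le> h"
    and "\<And>a b c d. (a, b) \<in> F \<Longrightarrow> (c, d) \<in> F \<Longrightarrow> b \<le> c \<or> d \<le> a \<or> (a \<le> c \<and> d \<le> b) \<or> (c \<le> a \<and> b \<le> d)"
    and "\<And>k. 0 < k \<Longrightarrow> k < h \<Longrightarrow> \<exists>x. (x, k) \<in> F \<or> (k, x) \<in> F"
  shows "F \<in> families h"
  unfolding families_def laminar_def separated_def intervals_def using assms by fast

lemma full_families_0: "full_families 0 = {}"
  by (auto simp: full_families_def families_def intervals_def)

lemma empty_in_families: "{} \<in> families h \<longleftrightarrow> h \<le> 1"
  by (auto simp: families_def laminar_def separated_def) (metis One_nat_def less_one not_less)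

lemma sum_full_families:
  fixes w :: "'a::comm_ring_1"
  assumes "0 < h"
  shows "(\<Sum>F\<in>full_families h. w ^ card F) =
    w * ((\<Sum>F\<in>families h. w ^ card F) - (\<Sum>F\<in>full_families h. w ^ card F))"
proof -
  have sub: "full_families h \<subseteq> families h" by (auto simp: full_families_def)
  have "(\<Sum>F\<in>full_families h. w ^ card F) = (\<Sum>F\<in>families h - full_families h. w * w ^ card F)"
  proof (rule sum.reindex_bij_witness[of _ "insert (0, h)" "\<lambda>F. F - {(0, h)}"])
    fix F assume F: "F \<in> full_families h"
    then have F': "F \<in> families h" "(0, h) \<in> F" by (auto simp: full_families_def)
    show "insert (0, h) (F - {(0, h)}) = F" using F' by auto
    have "F - {(0, h)} \<in> families h"
    proof (rule familiesI)
      fix k assume "0 < k" "k < h"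
      then show "\<exists>x. (x, k) \<in> F - {(0, h)} \<or> (k, x) \<in> F - {(0, h)}"
        using families_separatedD[OF F'(1), of k] by auto
    qed (use families_intervalD[OF F'(1)] families_laminarD[OF F'(1)] in auto)
    then show "F - {(0, h)} \<in> families h - full_families h"
      by (auto simp: full_families_def)
    show "w * w ^ card (F - {(0, h)}) = w ^ card F"
      using F' finite_family[OF F'(1)] by (metis card_Suc_Diff1 power_Suc)
  next
    fix F assume "F \<in> families h - full_families h"
    then have F: "F \<in> families h" "(0, h) \<notin> F" by (auto simp: full_families_def)
    then show "insert (0, h) F - {(0, h)} = F" by auto
    have "insert (0, h) F \<in> families h"
    proof (rule familiesI)
      fix a b c d assume "(a, b) \<in> insert (0, h) F" "(c, d) \<in> insert (0, h) F"
      then show "b \<le> c \<or> d \<le> a \<or> (a \<le> c \<and> d \<le> b) \<or> (c \<le> a \<and> b \<le> d)"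
        using families_laminarD[OF F(1), of a b c d] families_intervalD[OF F(1)] by auto
    next
      fix k assume "0 < k" "k < h"
      then show "\<exists>x. (x, k) \<in> insert (0, h) F \<or> (k, x) \<in> insert (0, h) F"
        using families_separatedD[OF F(1), of k] by auto
    qed (use assms families_intervalD[OF F(1)] in auto)
    then show "insert (0, h) F \<in> full_families h" by (auto simp: full_families_def)
  qed
  also have "\<dots> = w * ((\<Sum>F\<in>families h. w ^ card F) - (\<Sum>F\<in>full_families h. w ^ card F))"
    by (simp add: sum_distrib_left[symmetric] sum_diff[OF finite_families sub])
  finally show ?thesis .
qed

text \<open>
  The outermost member starting at the leftmost endpoint splits off; nothing crosses its right end.
\<close>

lemma first_block_bij:
  assumes "a \<le> 1" "a \<le> h"
  shows "bij_betw (\<lambda>(i, F1, F2). shift a F1 \<union> shift (a + i) F2)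
    (SIGMA i:{..h - a}. full_families i \<times> families (h - a - i))
    {F \<in> families h. F \<noteq> {} \<and> Min (fst ` F) = a}"
    (is "bij_betw ?f ?D ?R")
proof -
  have pos: "0 < i" if "F \<in> full_families i" for i F
    using that full_families_0 by (cases i) auto
  have le: "i' \<le> i" if "?f (i, F1, F2) = ?f (i', F1', F2')" "F1 \<in> full_families i"
      "F1' \<in> full_families i'" for i F1 F2 i' F1' F2'
  proof -
    have "(a, a + i') \<in> ?f (i', F1', F2')" using that(3) by (auto simp: mem_shift full_families_def)
    then have "(a, a + i') \<in> ?f (i, F1, F2)" using that(1) by simp
    then have "(0, i') \<in> F1" using pos[OF that(2)] by (auto simp: mem_shift)
    then show ?thesis using that(2) families_intervalD by (auto simp: full_families_def)
  qed
  have F1_eq: "F1 = {(x, y). (x + a, y + a) \<in> ?f (i, F1, F2) \<and> y \<le> i}"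
    if "F1 \<in> full_families i" "F2 \<in> families k" for i F1 F2 k
    using that families_intervalD[of F1 i] families_intervalD[of F2 k]
    by (fastforce simp: mem_shift full_families_def)
  have F2_eq: "F2 = {(x, y). (x + a + i, y + a + i) \<in> ?f (i, F1, F2)}"
    if "F1 \<in> full_families i" "F2 \<in> families k" for i F1 F2 k
    using that families_intervalD[of F1 i] families_intervalD[of F2 k]
    by (fastforce simp: mem_shift full_families_def)
  have "inj_on ?f ?D"
  proof (rule inj_onI)
    fix p q assume p: "p \<in> ?D" and q: "q \<in> ?D" and eq: "?f p = ?f q"
    obtain i F1 F2 i' F1' F2' where pq: "p = (i, F1, F2)" "q = (i', F1', F2')"
      by (metis prod_cases3)
    have m: "F1 \<in> full_families i" "F2 \<in> families (h - a - i)"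
      "F1' \<in> full_families i'" "F2' \<in> families (h - a - i')"
      using p q by (auto simp: pq)
    have i: "i = i'" using le[OF eq[unfolded pq] m(1,3)] le[OF eq[unfolded pq, symmetric] m(3,1)]
      by simp
    have eq': "?f (i', F1, F2) = ?f (i', F1', F2')" using eq by (simp only: pq i)
    note m' = m[unfolded i]
    have "F1 = F1'"
    proof -
      have "F1 = {(x, y). (x + a, y + a) \<in> ?f (i', F1, F2) \<and> y \<le> i'}" by (rule F1_eq[OF m'(1,2)])
      also have "\<dots> = {(x, y). (x + a, y + a) \<in> ?f (i', F1', F2') \<and> y \<le> i'}" by (simp only: eq')
      also have "\<dots> = F1'" by (rule F1_eq[OF m'(3,4), symmetric])
      finally show ?thesis .
    qed
    moreover have "F2 = F2'"
    proof -
      have "F2 = {(x, y). (x + a + i', y + a + i') \<in> ?f (i', F1, F2)}" by (rule F2_eq[OF m'(1,2)])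
      also have "\<dots> = {(x, y). (x + a + i', y + a + i') \<in> ?f (i', F1', F2')}" by (simp only: eq')
      also have "\<dots> = F2'" by (rule F2_eq[OF m'(3,4), symmetric])
      finally show ?thesis .
    qed
    ultimately have "F1 = F1'" "F2 = F2'" .
    then show "p = q" by (simp add: pq i)
  qed
  moreover have "?f p \<in> ?R" if p: "p \<in> ?D" for p
  proof -
    obtain i F1 F2 where pp: "p = (i, F1, F2)" by (metis prod_cases3)
    have i: "i \<le> h - a" and F1: "F1 \<in> families i" "(0, i) \<in> F1" and F2: "F2 \<in> families (h - a - i)"
      and i0: "0 < i"
      using p pos by (auto simp: pp full_families_def)
    have m1: "(x, y) \<in> shift a F1 \<Longrightarrow> a \<le> x \<and> x < y \<and> y \<le> a + i" for x y
      using families_intervalD[OF F1(1), of "x - a" "y - a"] by (auto simp: mem_shift)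
    have m2: "(x, y) \<in> shift (a + i) F2 \<Longrightarrow> a + i \<le> x \<and> x < y \<and> y \<le> h" for x y
      using families_intervalD[OF F2, of "x - (a + i)" "y - (a + i)"] by (auto simp: mem_shift)
    have fam: "?f p \<in> families h"
    proof (rule familiesI)
      fix x y assume "(x, y) \<in> ?f p"
      then show "x < y \<and> y \<le> h" using m1[of x y] m2[of x y] i assms(2) by (auto simp: pp)
    next
      fix x y x' y' assume "(x, y) \<in> ?f p" "(x', y') \<in> ?f p"
      then consider "(x, y) \<in> shift a F1" "(x', y') \<in> shift a F1"
        | "(x, y) \<in> shift a F1" "(x', y') \<in> shift (a + i) F2"
        | "(x, y) \<in> shift (a + i) F2" "(x', y') \<in> shift a F1"
        | "(x, y) \<in> shift (a + i) F2" "(x', y') \<in> shift (a + i) F2"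
        by (auto simp: pp)
      then show "y \<le> x' \<or> y' \<le> x \<or> (x \<le> x' \<and> y' \<le> y) \<or> (x' \<le> x \<and> y \<le> y')"
      proof cases
        case 1
        then show ?thesis
          using families_laminarD[OF F1(1), of "x - a" "y - a" "x' - a" "y' - a"]
          by (auto simp: mem_shift)
      next
        case 4
        then show ?thesis
          using families_laminarD[OF F2, of "x - (a + i)" "y - (a + i)" "x' - (a + i)" "y' - (a + i)"]
          by (auto simp: mem_shift)
      qed (use m1 m2 in fastforce)+
    next
      fix k assume k: "0 < k" "k < h"
      consider "k = a" | "k = a + i" | "a < k" "k < a + i" | "a + i < k"
        using k assms(1) by linarith
      then show "\<exists>x. (x, k) \<in> ?f p \<or> (k, x) \<in> ?f p"
      proof cases
        case 1
        then have "(k, a + i) \<in> ?f p" using F1(2) by (auto simp: pp mem_shift)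
        then show ?thesis by blast
      next
        case 2
        then have "(a, k) \<in> ?f p" using F1(2) by (auto simp: pp mem_shift)
        then show ?thesis by blast
      next
        case 3
        then obtain x where "(x, k - a) \<in> F1 \<or> (k - a, x) \<in> F1"
          using families_separatedD[OF F1(1), of "k - a"] by (metis less_diff_conv2 add.commute less_imp_le zero_less_diff)
        then have "(x + a, k) \<in> ?f p \<or> (k, x + a) \<in> ?f p"
          using 3 by (auto simp: pp mem_shift)
        then show ?thesis by blast
      next
        case 4
        then obtain x where "(x, k - a - i) \<in> F2 \<or> (k - a - i, x) \<in> F2"
          using families_separatedD[OF F2, of "k - a - i"] k
          by (metis diff_diff_left diff_less_mono less_imp_le zero_less_diff)
        then have "(x + a + i, k) \<in> ?f p \<or> (k, x + a + i) \<in> ?f p"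
          using 4 by (auto simp: pp mem_shift)
        then show ?thesis by blast
      qed
    qed
    have mem: "(a, a + i) \<in> ?f p" using F1(2) by (auto simp: pp mem_shift)
    have "Min (fst ` ?f p) = a"
    proof (rule Min_eqI)
      show "finite (fst ` ?f p)" using finite_family[OF fam] by simp
      show "a \<in> fst ` ?f p" using mem by force
      fix x assume "x \<in> fst ` ?f p"
      then show "a \<le> x" using m1 m2 by (fastforce simp: pp)
    qed
    then show ?thesis using fam mem by blast
  qed
  moreover have "F \<in> ?f ` ?D" if "F \<in> ?R" for F
  proof -
    have F: "F \<in> families h" "F \<noteq> {}" "Min (fst ` F) = a" using that by auto
    note fin = finite_family[OF F(1)]
    have amin: "a \<le> x" if "(x, y) \<in> F" for x y
      using F(3) fin that by (metis Min_le finite_imageI fst_conv image_eqI)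
    have "a \<in> fst ` F" using F fin Min_in[of "fst ` F"] by auto
    then obtain b0 where b0: "(a, b0) \<in> F" by auto
    define b where "b = Max {y. (a, y) \<in> F}"
    have finb: "finite {y. (a, y) \<in> F}"
      by (rule finite_subset[of _ "snd ` F"]) (use fin in force)+
    have ab: "(a, b) \<in> F" using Max_in[OF finb] b0 unfolding b_def by auto
    have bmax: "y \<le> b" if "(a, y) \<in> F" for y using Max_ge[OF finb] that unfolding b_def by auto
    have abh: "a < b" "b \<le> h" using families_intervalD[OF F(1) ab] by auto
    have split: "y \<le> b \<or> b \<le> x" if "(x, y) \<in> F" for x y
      using families_laminarD[OF F(1) that ab] families_intervalD[OF F(1) that] amin[OF that]
        bmax[of y] that by (cases "x = a") auto
    define F1 where "F1 = {(x, y). (x + a, y + a) \<in> F \<and> y + a \<le> b}"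
    define F2 where "F2 = {(x, y). (x + b, y + b) \<in> F}"
    have "F1 \<in> families (b - a)"
    proof (rule familiesI)
      fix x y assume "(x, y) \<in> F1"
      then show "x < y \<and> y \<le> b - a" using families_intervalD[OF F(1)] by (fastforce simp: F1_def)
    next
      fix x y x' y' assume "(x, y) \<in> F1" "(x', y') \<in> F1"
      then show "y \<le> x' \<or> y' \<le> x \<or> (x \<le> x' \<and> y' \<le> y) \<or> (x' \<le> x \<and> y \<le> y')"
        using families_laminarD[OF F(1), of "x + a" "y + a" "x' + a" "y' + a"]
        by (auto simp: F1_def)
    next
      fix k assume k: "0 < k" "k < b - a"
      then have "0 < k + a" "k + a < h" using abh by auto
      from families_separatedD[OF F(1) this]
      obtain x where x: "(x, k + a) \<in> F \<or> (k + a, x) \<in> F" by blast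
      then show "\<exists>x. (x, k) \<in> F1 \<or> (k, x) \<in> F1"
      proof
        assume *: "(x, k + a) \<in> F"
        then have "(x - a, k) \<in> F1" using amin[OF *] k by (auto simp: F1_def)
        then show ?thesis by blast
      next
        assume *: "(k + a, x) \<in> F"
        then have "(k, x - a) \<in> F1"
          using split[OF *] families_intervalD[OF F(1) *] k by (auto simp: F1_def)
        then show ?thesis by blast
      qed
    qed
    moreover have "(0, b - a) \<in> F1" using ab abh by (auto simp: F1_def)
    ultimately have F1: "F1 \<in> full_families (b - a)" by (auto simp: full_families_def)
    have F2: "F2 \<in> families (h - b)"
    proof (rule familiesI)
      fix x y assume "(x, y) \<in> F2"
      then show "x < y \<and> y \<le> h - b" using families_intervalD[OF F(1)] by (fastforce simp: F2_def)
    next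
      fix x y x' y' assume "(x, y) \<in> F2" "(x', y') \<in> F2"
      then show "y \<le> x' \<or> y' \<le> x \<or> (x \<le> x' \<and> y' \<le> y) \<or> (x' \<le> x \<and> y \<le> y')"
        using families_laminarD[OF F(1), of "x + b" "y + b" "x' + b" "y' + b"]
        by (auto simp: F2_def)
    next
      fix k assume k: "0 < k" "k < h - b"
      then have "0 < k + b" "k + b < h" using abh by auto
      from families_separatedD[OF F(1) this]
      obtain x where x: "(x, k + b) \<in> F \<or> (k + b, x) \<in> F" by blast
      then show "\<exists>x. (x, k) \<in> F2 \<or> (k, x) \<in> F2"
      proof
        assume *: "(x, k + b) \<in> F"
        then have "(x - b, k) \<in> F2" using split[OF *] k by (auto simp: F2_def)
        then show ?thesis by blast
      next
        assume *: "(k + b, x) \<in> F"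
        then have "(k, x - b) \<in> F2"
          using families_intervalD[OF F(1) *] k by (auto simp: F2_def)
        then show ?thesis by blast
      qed
    qed
    have "(x, y) \<in> shift a F1 \<union> shift b F2 \<longleftrightarrow> (x, y) \<in> F" for x y
      using split[of x y] amin[of x y] families_intervalD[OF F(1), of x y] abh
      by (auto simp: mem_shift F1_def F2_def)
    then have "F = ?f (b - a, F1, F2)" using abh by auto
    moreover have "(b - a, F1, F2) \<in> ?D" using F1 F2 abh by auto
    ultimately show ?thesis by blast
  qed
  ultimately show ?thesis by (auto simp: bij_betw_def)
qed

lemma sum_first_block:
  fixes w :: "'a::comm_ring_1"
  assumes "a \<le> 1" "a \<le> h"
  shows "(\<Sum>F | F \<in> families h \<and> F \<noteq> {} \<and> Min (fst ` F) = a. w ^ card F) =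
    (\<Sum>i\<le>h - a. (\<Sum>F\<in>full_families i. w ^ card F) * (\<Sum>F\<in>families (h - a - i). w ^ card F))"
proof -
  have fin: "finite (full_families i)" for i
    using finite_families by (auto simp: full_families_def)
  have card: "card (shift a F1 \<union> shift (a + i) F2) = card F1 + card F2"
    if "F1 \<in> full_families i" "F2 \<in> families k" for i k F1 F2
  proof -
    have "shift a F1 \<inter> shift (a + i) F2 = {}"
      using that families_intervalD[of F1 i] by (fastforce simp: mem_shift full_families_def)
    then show ?thesis
      using that finite_family[of F1 i] finite_family[of F2 k]
      by (subst card_Un_disjoint) (auto simp: card_shift full_families_def shift_def[of _ F1]
          shift_def[of _ F2], auto simp: shift_def[symmetric] card_shift)
  qed
  have "(\<Sum>F | F \<in> families h \<and> F \<noteq> {} \<and> Min (fst ` F) = a. w ^ card F) =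
    (\<Sum>(i, F1, F2)\<in>(SIGMA i:{..h - a}. full_families i \<times> families (h - a - i)).
       w ^ card (shift a F1 \<union> shift (a + i) F2))"
    by (subst sum.reindex_bij_betw[OF first_block_bij[OF assms], symmetric])
      (auto intro!: sum.cong)
  also have "\<dots> = (\<Sum>(i, F1, F2)\<in>(SIGMA i:{..h - a}. full_families i \<times> families (h - a - i)).
       w ^ card F1 * w ^ card F2)"
    by (rule sum.cong) (auto simp: card power_add)
  also have "\<dots> = (\<Sum>i\<le>h - a. \<Sum>(F1, F2)\<in>full_families i \<times> families (h - a - i).
       w ^ card F1 * w ^ card F2)"
    by (subst sum.Sigma) (auto simp: fin finite_families)
  also have "\<dots> = (\<Sum>i\<le>h - a. (\<Sum>F\<in>full_families i. w ^ card F) * (\<Sum>F\<in>families (h - a - i). w ^ card F))"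
    by (simp add: sum_product sum.cartesian_product)
  finally show ?thesis .
qed

definition family_gf :: "'a::comm_ring_1 \<Rightarrow> 'a fps" where
  "family_gf w = Abs_fps (\<lambda>h. \<Sum>F\<in>families h. w ^ card F)"

lemma family_gf_eq:
  fixes w :: "'a::comm_ring_1"
  defines "W \<equiv> fps_const w" and "g \<equiv> family_gf w"
  shows "W * (fps_X + 1) * g ^ 2 - (W * (fps_X + 2) + 1) * g + (1 + W) * (1 + fps_X) = 0"
proof -
  define J where "J = Abs_fps (\<lambda>h. \<Sum>F\<in>full_families h. w ^ card F)"
  have g_nth: "fps_nth g h = (\<Sum>F\<in>families h. w ^ card F)" for h
    by (simp add: g_def family_gf_def)
  have J_nth: "fps_nth J h = (\<Sum>F\<in>full_families h. w ^ card F)" for h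
    by (simp add: J_def)
  have fam0: "families 0 = {{}}"
    by (auto simp: families_def intervals_def laminar_def separated_def)
  have J_eq: "J = W * (g - 1 - J)"
  proof (rule fps_ext)
    fix h show "fps_nth J h = fps_nth (W * (g - 1 - J)) h"
      using sum_full_families[of h w]
      by (cases "h = 0") (auto simp: W_def J_nth g_nth full_families_0 fam0)
  qed
  have g_eq: "g = (1 + fps_X) * (1 + J * g)"
  proof (rule fps_ext)
    fix h
    define S where "S a = (\<Sum>F | F \<in> families h \<and> F \<noteq> {} \<and> Min (fst ` F) = a. w ^ card F)" for a
    have Jg: "fps_nth (J * g) (h - a) = S a" if "a \<le> 1" "a \<le> h" for a
      unfolding S_def sum_first_block[OF that] by (simp add: fps_mult_nth J_nth g_nth atLeast0AtMost)
    have min01: "Min (fst ` F) \<in> {0, 1}" if F: "F \<in> families h" "F \<noteq> {}" for F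
    proof (rule ccontr)
      assume neg: "Min (fst ` F) \<notin> {0, 1}"
      have fin: "finite (fst ` F)" using finite_family F by blast
      have m: "2 \<le> x" if "(x, y) \<in> F" for x y
      proof -
        have "Min (fst ` F) \<le> x" using fin that by (metis Min_le fst_conv image_eqI)
        then show ?thesis using neg by auto
      qed
      obtain x y where xy: "(x, y) \<in> F" using F(2) by auto
      then have "1 < h" using m families_intervalD[OF F(1) xy] by fastforce
      then obtain k where "(k, 1) \<in> F \<or> (1, k) \<in> F"
        using families_separatedD[OF F(1), of 1] by auto
      then show False using m families_intervalD[OF F(1)] by fastforce
    qed
    have "families h = {F \<in> families h. F = {}} \<union> ({F. F \<in> families h \<and> F \<noteq> {} \<and> Min (fst ` F) = 0}
        \<union> {F. F \<in> families h \<and> F \<noteq> {} \<and> Min (fst ` F) = 1})"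
      using min01 by auto
    then have "fps_nth g h = (\<Sum>F\<in>{F \<in> families h. F = {}} \<union>
       ({F. F \<in> families h \<and> F \<noteq> {} \<and> Min (fst ` F) = 0} \<union>
        {F. F \<in> families h \<and> F \<noteq> {} \<and> Min (fst ` F) = 1}). w ^ card F)"
      unfolding g_nth by (rule arg_cong)
    also have "\<dots> = (\<Sum>F | F \<in> families h \<and> F = {}. w ^ card F) + (S 0 + S 1)"
      unfolding S_def using finite_families[of h]
      by (subst sum.union_disjoint, simp, simp, force)+ simp
    also have "{F. F \<in> families h \<and> F = {}} = (if h \<le> 1 then {{}} else {})"
      using empty_in_families[of h] by auto
    also have "(\<Sum>F\<in>(if h \<le> 1 then {{}} else {}). w ^ card F) = (if h \<le> 1 then 1 else 0)"
      by simp
    finally have g: "fps_nth g h = (if h \<le> 1 then 1 else 0) + (S 0 + S 1)" .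
    have nth: "fps_nth ((1 + fps_X) * H) h = fps_nth H h + (if h = 0 then 0 else fps_nth H (h - 1))"
      for H :: "'a fps"
      by (simp add: distrib_right)
    show "fps_nth g h = fps_nth ((1 + fps_X) * (1 + J * g)) h"
    proof (cases "h = 0")
      case True
      have "S 1 = 0"
        unfolding S_def by (rule sum.neutral) (simp add: True fam0)
      moreover have "fps_nth (J * g) h = S 0" using Jg[of 0] by simp
      ultimately show ?thesis unfolding g nth using True by (simp only: fps_add_nth fps_one_nth) simp
    next
      case False
      have "fps_nth (J * g) h = S 0" "fps_nth (J * g) (h - 1) = S 1"
        using Jg[of 0] Jg[of 1] False by simp_all
      then show ?thesis unfolding g nth using False
        by (simp only: fps_add_nth fps_one_nth) (simp add: le_Suc_eq)
    qed
  qed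
  have "W * (fps_X + 1) * g ^ 2 - (W * (fps_X + 2) + 1) * g + (1 + W) * (1 + fps_X) =
    - (1 + W) * (g - (1 + fps_X) * (1 + J * g)) - (1 + fps_X) * (J - W * (g - 1 - J)) * g"
    by (simp add: algebra_simps power2_eq_square)
  moreover have "g - (1 + fps_X) * (1 + J * g) = 0" "J - W * (g - 1 - J) = 0"
    by (rule iffD2[OF right_minus_eq], rule g_eq) (rule iffD2[OF right_minus_eq], rule J_eq)
  ultimately show ?thesis
    by (simp only: mult_zero_right mult_zero_left diff_self)
qed

section \<open>Rows of a shape\<close>

definition before :: "'a::linorder set \<Rightarrow> 'a \<Rightarrow> nat" where
  "before E x = card {e \<in> E. e < x}"

lemma before_mono: "finite E \<Longrightarrow> x \<le> y \<Longrightarrow> before E x \<le> before E y"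
  unfolding before_def by (rule card_mono) auto

lemma before_strict:
  assumes "finite E" "e \<in> E" "x \<le> e" "e < y"
  shows "before E x < before E y"
proof -
  have "{z \<in> E. z < x} \<subseteq> {z \<in> E. z < y}" using assms by auto
  moreover have "e \<in> {z \<in> E. z < y}" "e \<notin> {z \<in> E. z < x}" using assms by auto
  ultimately have "{z \<in> E. z < x} \<subset> {z \<in> E. z < y}" by blast
  then show ?thesis unfolding before_def by (rule psubset_card_mono[rotated]) (simp add: assms(1))
qed

lemma before_less_iff: "finite E \<Longrightarrow> x \<in> E \<Longrightarrow> before E x < before E y \<longleftrightarrow> x < y"
  using before_mono[of E y x] before_strict[of E x x y] by (cases "x < y") (auto simp: not_less)

lemma before_inj: "finite E \<Longrightarrow> inj_on (before E) E"
  by (rule inj_onI) (metis before_less_iff less_irrefl linorder_less_linear)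

lemma before_le: "finite E \<Longrightarrow> before E x \<le> card E"
  unfolding before_def by (rule card_mono) auto

lemma before_image:
  assumes "finite E"
  shows "before E ` E = {..<card E}"
proof (rule card_subset_eq)
  have "before E e < card E" if "e \<in> E" for e
    unfolding before_def by (rule psubset_card_mono) (use assms that in auto)
  then show "before E ` E \<subseteq> {..<card E}" by auto
  show "card (before E ` E) = card {..<card E}"
    using card_image[OF before_inj[OF assms]] by simp
qed simp

definition ext_span :: "nat set \<Rightarrow> nat \<times> nat \<Rightarrow> nat \<times> nat" where
  "ext_span E = map_prod (before E) (before E)"

lemma ext_span_Pair [simp]: "ext_span E (i, j) = (before E i, before E j)"
  by (simp add: ext_span_def)

text \<open>
  One row of a shape: \<open>E\<close> is the set of endpoints of exterior arcs and \<open>P\<close> the set of interior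
  arcs. The injectivity of \<open>ext_span\<close> encodes that all interior stacks have length one.
\<close>

definition row :: "nat \<Rightarrow> nat set \<Rightarrow> (nat \<times> nat) set \<Rightarrow> bool" where
  "row n E P \<longleftrightarrow> E \<union> fst ` P \<union> snd ` P = {1..n} \<and>
     E \<inter> fst ` P = {} \<and> E \<inter> snd ` P = {} \<and> fst ` P \<inter> snd ` P = {} \<and>
     inj_on fst P \<and> inj_on snd P \<and>
     (\<forall>i j. (i, j) \<in> P \<longrightarrow> (\<exists>e\<in>E. i < e \<and> e < j)) \<and>
     (\<forall>i j k l. (i, j) \<in> P \<longrightarrow> (k, l) \<in> P \<longrightarrow> \<not> (i < k \<and> k < j \<and> j < l)) \<and>
     inj_on (ext_span E) P"

lemma row_facts:
  assumes "row n E P"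
  shows "finite E" "E \<union> fst ` P \<union> snd ` P = {1..n}"
    "E \<inter> fst ` P = {}" "E \<inter> snd ` P = {}" "fst ` P \<inter> snd ` P = {}"
    "\<And>i j l. (i, j) \<in> P \<Longrightarrow> (i, l) \<in> P \<Longrightarrow> j = l"
    "\<And>i j l. (j, i) \<in> P \<Longrightarrow> (l, i) \<in> P \<Longrightarrow> j = l"
    "\<And>i j. (i, j) \<in> P \<Longrightarrow> \<exists>e\<in>E. i < e \<and> e < j"
    "\<And>i j k l. (i, j) \<in> P \<Longrightarrow> (k, l) \<in> P \<Longrightarrow> \<not> (i < k \<and> k < j \<and> j < l)"
    "inj_on (ext_span E) P"
proof -
  show "finite E" using assms finite_subset[of E "{1..n}"] unfolding row_def by blast
  show "\<And>i j l. (i, j) \<in> P \<Longrightarrow> (i, l) \<in> P \<Longrightarrow> j = l"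
    using assms unfolding row_def by (metis fst_conv inj_onD prod.inject)
  show "\<And>i j l. (j, i) \<in> P \<Longrightarrow> (l, i) \<in> P \<Longrightarrow> j = l"
    using assms unfolding row_def by (metis snd_conv inj_onD prod.inject)
qed (use assms in \<open>unfold row_def, blast+\<close>)

lemma row_spans:
  assumes "row n E P"
  shows "ext_span E ` P \<subseteq> intervals (card E)" "laminar (ext_span E ` P)"
proof -
  note R = row_facts[OF assms]
  have less: "before E i < before E j" if ij: "(i, j) \<in> P" for i j
    using R(8)[OF ij] before_strict[OF R(1)] by (meson less_imp_le)
  then show "ext_span E ` P \<subseteq> intervals (card E)"
    using before_le[OF R(1)] by (auto simp: intervals_def)
  have "before E j \<le> before E k \<or> before E l \<le> before E i \<or>
      (before E i \<le> before E k \<and> before E l \<le> before E j) \<or>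
      (before E k \<le> before E i \<and> before E j \<le> before E l)"
    if ij: "(i, j) \<in> P" and kl: "(k, l) \<in> P" for i j k l
  proof -
    have "j \<le> k \<or> l \<le> i \<or> (i \<le> k \<and> l \<le> j) \<or> (k \<le> i \<and> j \<le> l)"
      using R(9)[OF ij kl] R(9)[OF kl ij] R(6)[OF ij, of l] kl
      by (cases "i = k") auto
    then show ?thesis using before_mono[OF R(1)] by blast
  qed
  then show "laminar (ext_span E ` P)" unfolding laminar_def by clarsimp blast
qed

text \<open>
  Reading a row from left to right, the vertices with \<open>g\<close> exterior endpoints before them are closing
  vertices (innermost arc first), then opening vertices (outermost arc first), then possibly an exterior
  endpoint. Hence the lexicographic order of the following keys is the order of the vertices.
\<close>

definition okey :: "nat \<times> nat \<Rightarrow> nat \<times> nat \<times> int" where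
  "okey = (\<lambda>(a, b). (a, 1, - int b))"

definition ckey :: "nat \<times> nat \<Rightarrow> nat \<times> nat \<times> int" where
  "ckey = (\<lambda>(a, b). (b, 0, - int a))"

definition ekey :: "nat \<Rightarrow> nat \<times> nat \<times> int" where
  "ekey r = (r, 2, 0)"

lemmas key_defs = okey_def ckey_def ekey_def

definition keys :: "nat \<Rightarrow> (nat \<times> nat) set \<Rightarrow> (nat \<times> nat \<times> int) set" where
  "keys h T = ekey ` {..<h} \<union> okey ` T \<union> ckey ` T"

definition pos :: "nat \<Rightarrow> (nat \<times> nat) set \<Rightarrow> nat \<times> nat \<times> int \<Rightarrow> nat" where
  "pos h T x = Suc (before (keys h T) x)"

definition ext_of :: "nat \<Rightarrow> (nat \<times> nat) set \<Rightarrow> nat set" where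
  "ext_of h T = (\<lambda>r. pos h T (ekey r)) ` {..<h}"

definition arcs_of :: "nat \<Rightarrow> (nat \<times> nat) set \<Rightarrow> (nat \<times> nat) set" where
  "arcs_of h T = (\<lambda>t. (pos h T (okey t), pos h T (ckey t))) ` T"

lemma row_unique:
  assumes row: "row n E P"
  defines "h \<equiv> card E" and "T \<equiv> ext_span E ` P"
  shows "n = card (keys h T)" "E = ext_of h T" "P = arcs_of h T"
    "\<And>e. e \<in> E \<Longrightarrow> e = pos h T (ekey (before E e))"
proof -
  note R = row_facts[OF row]
  let ?c = "before E"
  note mono = before_mono[OF R(1)] and strict = before_strict[OF R(1)]
  have same: False if "e \<in> E" "x \<le> e" "e < y" "?c x = ?c y" for e x y
    using strict[OF that(1-3)] that(4) by simp
  define key where "key i = (if i \<in> E then ekey (?c i)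
    else if i \<in> fst ` P then okey (?c i, ?c (THE j. (i, j) \<in> P))
    else ckey (?c (THE j. (j, i) \<in> P), ?c i))" for i
  have key_e: "key i = ekey (?c i)" if "i \<in> E" for i
    using that by (simp add: key_def)
  have key_o: "key i = okey (?c i, ?c j)" if ij: "(i, j) \<in> P" for i j
  proof -
    have "i \<notin> E" "i \<in> fst ` P" using R(3) ij by force+
    moreover have "(THE j. (i, j) \<in> P) = j" using R(6) ij by blast
    ultimately show ?thesis by (simp add: key_def)
  qed
  have key_c: "key j = ckey (?c i, ?c j)" if ij: "(i, j) \<in> P" for i j
  proof -
    have "j \<notin> E" "j \<notin> fst ` P" using R(4,5) ij by force+
    moreover have "(THE i. (i, j) \<in> P) = i" using R(7) ij by blast
    ultimately show ?thesis by (simp add: key_def)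
  qed
  have cases: "i \<in> E \<or> (\<exists>j. (i, j) \<in> P) \<or> (\<exists>j. (j, i) \<in> P)" if "i \<in> {1..n}" for i
    using that unfolding R(2)[symmetric] by auto
  have smono: "key x < key y" if x: "x \<in> {1..n}" and y: "y \<in> {1..n}" and xy: "x < y" for x y
  proof -
    have le: "?c x \<le> ?c y" using mono xy by simp
    consider (e) "x \<in> E"
      | (o) k where "(x, k) \<in> P" "x \<notin> E"
      | (c) k where "(k, x) \<in> P" "x \<notin> E"
      using cases[OF x] by blast
    then show ?thesis
    proof cases
      case e
      then have "?c x < ?c y" using strict[of x x y] xy by simp
      then show ?thesis using cases[OF y] key_e[OF e] key_e[of y] key_o[of y] key_c[of _ y]
        by (cases "?c x = ?c y") (auto simp: key_defs)
    next
      case (o k)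
      note o' = R(8)[OF o(1)]
      consider (e) "y \<in> E" | (o) l where "(y, l) \<in> P" | (c) l where "(l, y) \<in> P"
        using cases[OF y] by blast
      then show ?thesis
      proof cases
        case e
        then show ?thesis using le_neq_implies_less[OF le] key_o[OF o(1)] key_e[OF e] by (cases "?c x = ?c y") (auto simp: key_defs)
      next
        case (o l)
        have "?c l < ?c k" if eq: "?c x = ?c y"
        proof -
          have "y < k" using o' same[of _ x y] eq by (meson le_less_trans less_imp_le not_le)
          then have "l \<le> k" using R(9)[OF \<open>(x, k) \<in> P\<close> o] xy by auto
          moreover have "?c l \<noteq> ?c k"
            using inj_onD[OF R(10), of "(x, k)" "(y, l)"] \<open>(x, k) \<in> P\<close> o eq xy by auto
          ultimately show ?thesis using mono[of l k] by simp
        qed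
        then show ?thesis using le_neq_implies_less[OF le] key_o[OF \<open>(x, k) \<in> P\<close>] key_o[OF o]
          by (cases "?c x = ?c y") (auto simp: key_defs)
      next
        case (c l)
        have "?c x \<noteq> ?c y"
        proof
          assume eq: "?c x = ?c y"
          have "x = l \<or> k < y \<or> x < l"
            using R(9)[OF c \<open>(x, k) \<in> P\<close>] xy R(7)[OF c, of x] \<open>(x, k) \<in> P\<close>
            by (cases "y = k") auto
          then show False
            using o' R(8)[OF c] same[OF _ _ _ eq] by (meson less_imp_le less_trans)
        qed
        then show ?thesis using le_neq_implies_less[OF le] key_o[OF o(1)] key_c[OF c] by (cases "?c x = ?c y") (auto simp: key_defs)
      qed
    next
      case (c k)
      consider (e) "y \<in> E" | (o) l where "(y, l) \<in> P" | (c) l where "(l, y) \<in> P"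
        using cases[OF y] by blast
      then show ?thesis
      proof cases
        case e
        then show ?thesis using le_neq_implies_less[OF le] key_c[OF c(1)] key_e[OF e] by (cases "?c x = ?c y") (auto simp: key_defs)
      next
        case (o l)
        then show ?thesis using le_neq_implies_less[OF le] key_c[OF c(1)] key_o[OF o] by (cases "?c x = ?c y") (auto simp: key_defs)
      next
        case (c l)
        have "?c l < ?c k" if eq: "?c x = ?c y"
        proof -
          have "l < x" using R(8)[OF c] same[of _ x y] eq by (meson less_le_trans less_imp_le not_le)
          then have "l \<le> k" using R(9)[OF \<open>(k, x) \<in> P\<close> c] xy by auto
          moreover have "?c l \<noteq> ?c k"
            using inj_onD[OF R(10), of "(k, x)" "(l, y)"] \<open>(k, x) \<in> P\<close> c eq xy by auto
          ultimately show ?thesis using mono[of l k] by simp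
        qed
        then show ?thesis using le_neq_implies_less[OF le] key_c[OF \<open>(k, x) \<in> P\<close>] key_c[OF c] by (cases "?c x = ?c y") (auto simp: key_defs)
      qed
    qed
  qed
  have less_iff: "key x < key y \<longleftrightarrow> x < y" if "x \<in> {1..n}" "y \<in> {1..n}" for x y
    using smono[OF that] smono[OF that(2,1)] by (metis less_asym' linorder_neqE_nat)
  have inj: "inj_on key {1..n}"
    by (rule inj_onI) (metis less_iff less_irrefl linorder_neqE_nat)
  have "key ` {1..n} = key ` E \<union> key ` fst ` P \<union> key ` snd ` P"
    unfolding R(2)[symmetric] by blast
  also have "key ` E = ekey ` {..<h}"
    unfolding h_def before_image[OF R(1), symmetric] image_image by (rule image_cong) (auto simp: key_e)
  also have "key ` fst ` P = okey ` T"
    unfolding T_def image_image by (rule image_cong) (auto simp: key_o)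
  also have "key ` snd ` P = ckey ` T"
    unfolding T_def image_image by (rule image_cong) (auto simp: key_c)
  finally have img: "key ` {1..n} = keys h T" by (simp add: keys_def)
  show "n = card (keys h T)" using card_image[OF inj] img by simp
  have pos: "pos h T (key i) = i" if i: "i \<in> {1..n}" for i
  proof -
    have "{e \<in> keys h T. e < key i} = key ` {1..<i}"
      unfolding img[symmetric] using less_iff i by auto
    moreover have "card (key ` {1..<i}) = card {1..<i}"
      by (rule card_image, rule inj_on_subset[OF inj]) (use i in auto)
    ultimately show ?thesis using i by (simp add: pos_def before_def)
  qed
  have En: "e \<in> {1..n}" if "e \<in> E" for e using R(2) that by blast
  show posE: "e = pos h T (ekey (?c e))" if "e \<in> E" for e
    using pos[OF En[OF that]] key_e[OF that] by simp
  have "E = (\<lambda>e. pos h T (ekey (?c e))) ` E"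
    using posE by force
  also have "\<dots> = ext_of h T"
    unfolding ext_of_def h_def before_image[OF R(1), symmetric] image_image ..
  finally show "E = ext_of h T" .
  have "(pos h T (okey (ext_span E p)), pos h T (ckey (ext_span E p))) = p" if "p \<in> P" for p
  proof (cases p)
    case (Pair i j)
    have "i \<in> {1..n}" "j \<in> {1..n}" using that R(2) unfolding Pair by force+
    then show ?thesis using pos[of i] pos[of j] key_o[of i j] key_c[of i j] that
      by (simp add: Pair)
  qed
  then show "P = arcs_of h T"
    unfolding arcs_of_def T_def image_image by force
qed

lemma row_exists:
  assumes T: "T \<subseteq> intervals h" and lam: "laminar T"
  shows "row (card (keys h T)) (ext_of h T) (arcs_of h T)" "card (ext_of h T) = h"
    "ext_span (ext_of h T) ` arcs_of h T = T" "card (arcs_of h T) = card T"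
    "\<And>r. r < h \<Longrightarrow> before (ext_of h T) (pos h T (ekey r)) = r"
proof -
  let ?K = "keys h T" and ?E = "ext_of h T" and ?P = "arcs_of h T" and ?p = "pos h T"
  have finT: "finite T" using T finite_intervals finite_subset by blast
  then have finK: "finite ?K" by (simp add: keys_def)
  have less: "?p x < ?p y \<longleftrightarrow> x < y" if "x \<in> ?K" for x y
    using before_less_iff[OF finK that] by (simp add: pos_def)
  have eq: "?p x = ?p y \<longleftrightarrow> x = y" if "x \<in> ?K" "y \<in> ?K" for x y
    using less[OF that(1), of y] less[OF that(2), of x] by (metis less_irrefl linorder_less_linear)
  have K: "ekey r \<in> ?K" if "r < h" for r using that by (simp add: keys_def)
  have KT: "okey t \<in> ?K" "ckey t \<in> ?K" if "t \<in> T" for t using that by (simp_all add: keys_def)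
  have Tlt: "a < b \<and> b \<le> h" if "(a, b) \<in> T" for a b using T that by (auto simp: intervals_def)
  have less_e: "?p (ekey r) < ?p x \<longleftrightarrow> ekey r < x" if "r < h" for r x
    by (rule less[OF K[OF that]])
  have inj_e: "inj_on (\<lambda>r. ?p (ekey r)) {..<h}"
    by (rule inj_onI) (use eq[OF K K] in \<open>simp add: ekey_def\<close>)
  then show "card ?E = h" by (simp add: ext_of_def card_image)
  have before: "before ?E (?p x) = card {r. r < h \<and> ekey r < x}" for x
  proof -
    have "{e \<in> ?E. e < ?p x} = (\<lambda>r. ?p (ekey r)) ` {r. r < h \<and> ekey r < x}"
      using less_e[where x = x] by (auto simp: ext_of_def)
    then show ?thesis
      unfolding before_def by (simp add: card_image inj_on_subset[OF inj_e] subset_iff)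
  qed
  show before_e: "before ?E (?p (ekey r)) = r" if "r < h" for r
  proof -
    have "{s. s < h \<and> ekey s < ekey r} = {..<r}" using that by (auto simp: ekey_def)
    then show ?thesis by (simp add: before)
  qed
  have before_o: "before ?E (?p (okey (a, b))) = a" if "(a, b) \<in> T" for a b
  proof -
    have "{s. s < h \<and> ekey s < okey (a, b)} = {..<a}" using Tlt[OF that] by (auto simp: key_defs)
    then show ?thesis by (simp add: before)
  qed
  have before_c: "before ?E (?p (ckey (a, b))) = b" if "(a, b) \<in> T" for a b
  proof -
    have "{s. s < h \<and> ekey s < ckey (a, b)} = {..<b}" using Tlt[OF that] by (auto simp: key_defs)
    then show ?thesis by (simp add: before)
  qed
  have span_arc: "ext_span ?E (?p (okey t), ?p (ckey t)) = t" if "t \<in> T" for t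
    using that before_o before_c by (cases t) auto
  then show "ext_span ?E ` ?P = T" unfolding arcs_of_def image_image by simp
  have inj_span: "inj_on (ext_span ?E) ?P"
    unfolding arcs_of_def by (rule inj_onI) (use span_arc in force)
  have inj_arc: "inj_on (\<lambda>t. (?p (okey t), ?p (ckey t))) T"
    by (rule inj_onI) (metis span_arc)
  then show "card ?P = card T" by (simp add: arcs_of_def card_image)
  have ok: "okey t = okey t' \<longleftrightarrow> t = t'" "ckey t = ckey t' \<longleftrightarrow> t = t'" "okey t \<noteq> ckey t'"
    "ekey r \<noteq> okey t" "ekey r \<noteq> ckey t" for t t' r
    by (auto simp: key_defs split: prod.splits)
  show "row (card ?K) ?E ?P"
    unfolding row_def
  proof (intro conjI allI impI)
    have "?E \<union> fst ` ?P \<union> snd ` ?P = ?p ` ?K"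
      unfolding ext_of_def arcs_of_def keys_def image_Un image_image by simp
    also have "\<dots> = Suc ` before ?K ` ?K" by (simp add: pos_def image_image)
    also have "\<dots> = {1..card ?K}"
      unfolding before_image[OF finK] by (auto simp: image_Suc_lessThan)
    finally show "?E \<union> fst ` ?P \<union> snd ` ?P = {1..card ?K}" .
    have ne: "?p (ekey r) \<noteq> ?p (okey t)" "?p (ekey r) \<noteq> ?p (ckey t)" "?p (okey t) \<noteq> ?p (ckey t')"
      if "r < h" "t \<in> T" "t' \<in> T" for r t t'
      using eq[OF K KT(1)] eq[OF K KT(2)] eq[OF KT(1) KT(2)] ok(3-5) that by simp_all
    show "?E \<inter> fst ` ?P = {}" "?E \<inter> snd ` ?P = {}"
      unfolding ext_of_def arcs_of_def image_image fst_conv snd_conv lessThan_def using ne by blast+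
    have "0 < h" if "t \<in> T" for t using T that by (auto simp: intervals_def)
    then show "fst ` ?P \<inter> snd ` ?P = {}"
      unfolding arcs_of_def image_image fst_conv snd_conv using ne by blast
    show "inj_on fst ?P" "inj_on snd ?P"
      using eq[OF KT(1) KT(1)] eq[OF KT(2) KT(2)] ok(1,2) by (simp_all add: inj_on_def arcs_of_def)
    show "inj_on (ext_span ?E) ?P" by (rule inj_span)
  next
    fix i j assume "(i, j) \<in> ?P"
    then obtain a b where ab: "(a, b) \<in> T" "i = ?p (okey (a, b))" "j = ?p (ckey (a, b))"
      by (auto simp: arcs_of_def)
    have "a < h" "i < ?p (ekey a)" "?p (ekey a) < j"
      using less[OF KT(1)[OF ab(1)], of "ekey a"] less_e[of a "ckey (a, b)"] Tlt[OF ab(1)]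
      unfolding ab(2,3) by (simp_all add: key_defs)
    then show "\<exists>e\<in>?E. i < e \<and> e < j" by (auto simp: ext_of_def)
  next
    fix i j k l assume "(i, j) \<in> ?P" "(k, l) \<in> ?P"
    then obtain a b c d where ab: "(a, b) \<in> T" "i = ?p (okey (a, b))" "j = ?p (ckey (a, b))"
      and cd: "(c, d) \<in> T" "k = ?p (okey (c, d))" "l = ?p (ckey (c, d))"
      by (auto simp: arcs_of_def)
    have "b \<le> c \<or> d \<le> a \<or> (a \<le> c \<and> d \<le> b) \<or> (c \<le> a \<and> b \<le> d)"
      using lam ab(1) cd(1) unfolding laminar_def by blast
    then show "\<not> (i < k \<and> k < j \<and> j < l)"
      using Tlt[OF ab(1)] Tlt[OF cd(1)]
      unfolding ab(2,3) cd(2,3) less[OF KT(1)[OF ab(1)]] less[OF KT(1)[OF cd(1)]] less[OF KT(2)[OF ab(1)]]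
      by (auto simp: key_defs)
  qed
qed

lemma rowI:
  assumes "E \<union> fst ` P \<union> snd ` P = {1..n}"
    and "E \<inter> fst ` P = {}" "E \<inter> snd ` P = {}" "fst ` P \<inter> snd ` P = {}"
    and R6: "\<And>i j l. (i, j) \<in> P \<Longrightarrow> (i, l) \<in> P \<Longrightarrow> j = l"
    and R7: "\<And>i j l. (j, i) \<in> P \<Longrightarrow> (l, i) \<in> P \<Longrightarrow> j = l"
    and R8: "\<And>i j. (i, j) \<in> P \<Longrightarrow> \<exists>e\<in>E. i < e \<and> e < j"
    and R9: "\<And>i j k l. (i, j) \<in> P \<Longrightarrow> (k, l) \<in> P \<Longrightarrow> \<not> (i < k \<and> k < j \<and> j < l)"
    and stack: "\<And>i j. (i, j) \<in> P \<Longrightarrow> (i + 1, j - 1) \<notin> P"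
  shows "row n E P"
proof -
  let ?c = "before E"
  have fin: "finite E" using assms(1) finite_subset[of E "{1..n}"] by blast
  note strict = before_strict[OF fin]
  have dist: False if ij: "(i, j) \<in> P" and kl: "(k, l) \<in> P" and lt: "i < k"
    and eq: "?c i = ?c k" "?c j = ?c l" for i j k l
  proof -
    obtain e where e: "e \<in> E" "i < e" "e < j" using R8[OF ij] by blast
    obtain f where f: "f \<in> E" "k < f" "f < l" using R8[OF kl] by blast
    have gap1: "\<not> (x \<in> E \<and> i \<le> x \<and> x < k)" for x using strict[of x i k] eq by auto
    have kj: "k < j" using gap1[of e] e by auto
    have "l \<le> j" using R9[OF ij kl] lt kj by auto
    moreover have "l \<noteq> j" using R7[OF ij, of k] kl lt by auto
    ultimately have lj: "l < j" by simp
    have gap2: "\<not> (x \<in> E \<and> l \<le> x \<and> x < j)" for x using strict[of x l j] eq by auto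
    have V: "x \<in> E \<or> (\<exists>y. (x, y) \<in> P) \<or> (\<exists>y. (y, x) \<in> P)" if "1 \<le> x" "x \<le> n" for x
    proof -
      have "x \<in> E \<union> fst ` P \<union> snd ` P" unfolding assms(1) using that by simp
      then show ?thesis by auto
    qed
    have "i \<in> {1..n}" "j \<in> {1..n}" unfolding assms(1)[symmetric] using ij by force+
    then have ijn: "1 \<le> i" "j \<le> n" by auto
    have o: "\<exists>y. (i + 1, y) \<in> P"
    proof (rule ccontr)
      assume no: "\<not> ?thesis"
      have "k \<noteq> i + 1" using no kl by blast
      then have kne: "i + 1 < k" using lt by simp
      then have "i + 1 \<notin> E" using gap1[of "i + 1"] by auto
      then obtain x where x: "(x, i + 1) \<in> P" using V[of "i + 1"] no ijn kj lt by auto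
      obtain e where "e \<in> E" "x < e" "e < i + 1" using R8[OF x] by blast
      then have "x < i" using gap1[of e] kne by (cases "e = i") auto
      then show False using R9[OF x ij] kj lt kne by auto
    qed
    then obtain y where y: "(i + 1, y) \<in> P" by blast
    have o: "\<exists>x. (x, j - 1) \<in> P"
    proof (rule ccontr)
      assume no: "\<not> ?thesis"
      have "l \<noteq> j - 1" using no kl by blast
      then have kne: "l < j - 1" using lj by simp
      then have "j - 1 \<notin> E" using gap2[of "j - 1"] by auto
      then obtain x where x: "(j - 1, x) \<in> P" using V[of "j - 1"] no ijn kne
        by (metis One_nat_def Suc_leI diff_le_self gr_implies_not0 le_trans not_gr_zero)
      obtain e where e: "e \<in> E" "j - 1 < e" "e < x" using R8[OF x] by blast
      have "j \<notin> E" using assms(3) ij by force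
      then have "e \<noteq> j" using e by blast
      then have "j < x" using e by auto
      then show False using R9[OF ij x] kj lt kne f by auto
    qed
    then obtain x where x: "(x, j - 1) \<in> P" by blast
    have "y \<noteq> j" using R7[OF ij, of "i + 1"] y by auto
    then have yj: "y \<le> j - 1" using R9[OF ij y] e(2,3) by auto
    have yne: "y \<noteq> j - 1" using stack[OF ij] y by blast
    obtain e' where e': "e' \<in> E" "i + 1 < e'" "e' < y" using R8[OF y] by blast
    have ky: "k < y" using gap1[of e'] e' by auto
    have ly: "l \<le> y"
      using R9[OF y kl] R6[OF y, of l] kl ky lt by (cases "k = i + 1") auto
    obtain f' where f': "f' \<in> E" "x < f'" "f' < j - 1" using R8[OF x] by blast
    have xl: "x < l" using gap2[of f'] f' by auto
    have "x \<noteq> i + 1" using R6[OF y] x yne by blast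
    then have "x < i + 1" using R9[OF y x] xl ly yj yne by auto
    moreover have "x \<noteq> i" using R6[OF ij, of "j - 1"] x e(3) by auto
    ultimately have "x < i" by simp
    then show False using R9[OF x ij] lt f(2,3) lj by auto
  qed
  have "inj_on (ext_span E) P"
  proof (rule inj_onI)
    fix p q assume p: "p \<in> P" "q \<in> P" "ext_span E p = ext_span E q"
    obtain i j k l where pq: "p = (i, j)" "q = (k, l)" by (metis surj_pair)
    have "i = k"
      using dist[of i j k l] dist[of k l i j] p unfolding pq by (cases i k rule: linorder_cases) auto
    then show "p = q" using R6[of i j l] p unfolding pq by simp
  qed
  moreover have "inj_on fst P" "inj_on snd P" using R6 R7 by (auto simp: inj_on_def)
  ultimately show ?thesis using assms(1-4) R8 R9 unfolding row_def by (intro conjI allI impI) simp_all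
qed

lemma row_adjacent:
  assumes row: "row n E P" and k: "k \<in> E" and l: "l \<in> E" and kl: "before E l = Suc (before E k)"
  shows "l = Suc k \<longleftrightarrow> \<not> (\<exists>x. (x, before E l) \<in> ext_span E ` P \<or> (before E l, x) \<in> ext_span E ` P)"
proof -
  note R = row_facts[OF row]
  let ?c = "before E"
  note mono = before_mono[OF R(1)] and strict = before_strict[OF R(1)]
  have lt: "k < l" using before_less_iff[OF R(1) k, of l] kl by simp
  have gap: "i \<notin> E" if "k < i" "i < l" for i
    using strict[of k k i] strict[of i i l] that k kl by auto
  have ci: "?c i = ?c l \<longleftrightarrow> k < i \<and> i < l" if "i \<notin> E" for i
  proof (cases i l rule: linorder_cases)
    case less
    show ?thesis
    proof (cases "k < i")
      case True
      then show ?thesis using strict[of k k i] mono[of i l] less k kl by auto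
    next
      case False
      then show ?thesis using mono[of i k] kl by auto
    qed
  next
    case equal
    then show ?thesis using l that by blast
  next
    case greater
    then show ?thesis using strict[of l l i] l by auto
  qed
  have nP: "i \<notin> E" "j \<notin> E" if "(i, j) \<in> P" for i j using R(3,4) that by force+
  have "(\<exists>x. (x, ?c l) \<in> ext_span E ` P \<or> (?c l, x) \<in> ext_span E ` P) \<longleftrightarrow>
      (\<exists>i j. (i, j) \<in> P \<and> (?c i = ?c l \<or> ?c j = ?c l))"
    by (force simp: image_iff)
  also have "\<dots> \<longleftrightarrow> (\<exists>i j. (i, j) \<in> P \<and> ((k < i \<and> i < l) \<or> (k < j \<and> j < l)))"
    using ci nP by blast
  also have "\<dots> \<longleftrightarrow> (\<exists>i. k < i \<and> i < l)"
  proof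
    assume "\<exists>i. k < i \<and> i < l"
    then obtain i where i: "k < i" "i < l" by blast
    have "k \<in> {1..n}" "l \<in> {1..n}" using R(2) k l by blast+
    then have "i \<in> E \<union> fst ` P \<union> snd ` P" unfolding R(2) using i by auto
    then show "\<exists>i j. (i, j) \<in> P \<and> ((k < i \<and> i < l) \<or> (k < j \<and> j < l))" using gap[OF i] i by force
  qed blast
  also have "\<dots> \<longleftrightarrow> l \<noteq> Suc k" using lt by presburger
  finally show ?thesis by blast
qed

lemma row_under_iff:
  assumes "row n E P" "(i, j) \<in> P" "e \<in> E"
  shows "i < e \<and> e < j \<longleftrightarrow> before E i \<le> before E e \<and> before E e < before E j"
proof -
  note R = row_facts[OF assms(1)]
  have "i \<noteq> e" using R(3) assms(2,3) by force
  then have "i < e \<longleftrightarrow> \<not> e < i" by auto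
  then show ?thesis
    using before_less_iff[OF R(1) assms(3), of i] before_less_iff[OF R(1) assms(3), of j]
    by linarith
qed

section \<open>Shapes as pairs of rows\<close>

definition tops :: "arc set \<Rightarrow> (nat \<times> nat) set" where
  "tops A = {(i, j). TopArc i j \<in> A}"

definition bots :: "arc set \<Rightarrow> (nat \<times> nat) set" where
  "bots A = {(i, j). BotArc i j \<in> A}"

definition ext_top :: "arc set \<Rightarrow> nat set" where
  "ext_top A = {k. \<exists>k'. ExtArc k k' \<in> A}"

definition ext_bot :: "arc set \<Rightarrow> nat set" where
  "ext_bot A = {k'. \<exists>k. ExtArc k k' \<in> A}"

definition matched_rows :: "nat \<Rightarrow> nat \<Rightarrow> arc set \<Rightarrow> bool" where
  "matched_rows n m A \<longleftrightarrow> row n (ext_top A) (tops A) \<and> row m (ext_bot A) (bots A) \<and>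
     card (ext_top A) = card (ext_bot A) \<and>
     (\<forall>k k'. ExtArc k k' \<in> A \<longleftrightarrow>
        k \<in> ext_top A \<and> k' \<in> ext_bot A \<and> before (ext_top A) k = before (ext_bot A) k')"

definition top_spans :: "arc set \<Rightarrow> (nat \<times> nat) set" where
  "top_spans A = ext_span (ext_top A) ` tops A"

definition bot_spans :: "arc set \<Rightarrow> (nat \<times> nat) set" where
  "bot_spans A = ext_span (ext_bot A) ` bots A"

lemma long_stack_exists:
  assumes "finite A" and card_seq: "\<And>i j l. card (seq i j l) \<le> l"
    and "seq i j l \<subseteq> A" "2 \<le> card (seq i j l)"
  shows "\<exists>i j l. maximal_seq seq A i j l \<and> l \<noteq> 1"
proof -
  define S where "S = {X. X \<subseteq> A \<and> (\<exists>i j l. X = seq i j l)}"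
  have fin: "finite S" by (rule finite_subset[of _ "Pow A"]) (auto simp: S_def assms(1))
  have "seq i j l \<in> S" using assms(3) by (auto simp: S_def)
  from finite_has_maximal2[OF fin this]
  obtain M where M: "M \<in> S" "seq i j l \<subseteq> M" "\<forall>X\<in>S. M \<subseteq> X \<longrightarrow> M = X" by blast
  then obtain i' j' l' where M': "M = seq i' j' l'" "M \<subseteq> A" by (auto simp: S_def)
  have "2 \<le> card M"
    using assms(4) card_mono[OF finite_subset[OF M'(2) assms(1)] M(2)] by simp
  then have "2 \<le> l'" using card_seq[of i' j' l'] M'(1) by simp
  moreover have "maximal_seq seq A i' j' l'"
    unfolding maximal_seq_def
  proof (intro conjI notI)
    assume "\<exists>i j l. seq i j l \<subseteq> A \<and> seq i' j' l' \<subset> seq i j l"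
    then obtain i j l where X: "seq i j l \<subseteq> A" "M \<subset> seq i j l" unfolding M'(1) by blast
    then have "seq i j l \<in> S" unfolding S_def by blast
    then show False using M(3) X(2) by blast
  qed (use M' \<open>2 \<le> l'\<close> in auto)
  ultimately show ?thesis by (intro exI[of _ i'] exI[of _ j'] exI[of _ l']) auto
qed

lemma card_image_lessThan_le: "card (f ` {..<l::nat}) \<le> l"
  using card_image_le[of "{..<l}" f] by simp

lemma lessThan_2: "{..<2::nat} = {0, 1}"
  by auto

lemma shape_no_stack:
  assumes sh: "shape n m A"
  shows "TopArc i j \<in> A \<Longrightarrow> TopArc (i + 1) (j - 1) \<notin> A"
    "BotArc i j \<in> A \<Longrightarrow> BotArc (i + 1) (j - 1) \<notin> A"
    "ExtArc k k' \<in> A \<Longrightarrow> ExtArc (k + 1) (k' + 1) \<notin> A"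
proof -
  have fin: "finite A"
    using sh finite_pre_structure unfolding shape_def joint_structure_def by blast
  have st: "maximal_seq top_seq A i j l \<Longrightarrow> l = 1" "maximal_seq bot_seq A i j l \<Longrightarrow> l = 1"
    "maximal_seq ext_seq A i j l \<Longrightarrow> l = 1" for i j l
    using sh unfolding shape_def interior_stack_def exterior_stack_def by blast+
  have top_card: "card (top_seq i j l) \<le> l" and bot_card: "card (bot_seq i j l) \<le> l"
    and ext_card: "card (ext_seq i j l) \<le> l" for i j l
    unfolding top_seq_def bot_seq_def ext_seq_def by (rule card_image_lessThan_le)+
  show "TopArc (i + 1) (j - 1) \<notin> A" if "TopArc i j \<in> A"
    using long_stack_exists[OF fin, where seq = top_seq and i = i and j = j and l = 2, OF top_card] st(1) that
    by (auto simp: top_seq_def lessThan_2)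
  show "BotArc (i + 1) (j - 1) \<notin> A" if "BotArc i j \<in> A"
    using long_stack_exists[OF fin, where seq = bot_seq and i = i and j = j and l = 2, OF bot_card] st(2) that
    by (auto simp: bot_seq_def lessThan_2)
  show "ExtArc (k + 1) (k' + 1) \<notin> A" if "ExtArc k k' \<in> A"
    using long_stack_exists[OF fin, where seq = ext_seq and i = k and j = k' and l = 2, OF ext_card] st(3) that
    by (auto simp: ext_seq_def lessThan_2)
qed

lemma shape_matched_rows:
  assumes sh: "shape n m A"
  shows "matched_rows n m A"
proof -
  have pre: "pre_structure n m A" and nss: "no_secondary_segments n m A"
    using sh unfolding shape_def joint_structure_def by auto
  have sub: "endpoints a \<subseteq> vertices n m" if "a \<in> A" for a
    using pre that unfolding pre_structure_def by blast
  have U: "a = b" if "a \<in> A" "b \<in> A" "x \<in> endpoints a" "x \<in> endpoints b" for a b x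
    using pre that unfolding pre_structure_def by blast
  have cover: "\<exists>a\<in>A. x \<in> endpoints a" if "x \<in> vertices n m" for x
    using nss that unfolding no_secondary_segments_def by blast
  have top: "\<exists>e\<in>ext_top A. i < e \<and> e < j" if "TopArc i j \<in> A" for i j
  proof -
    have "descendants A (TopArc i j) \<noteq> {}"
      using nss that unfolding no_secondary_segments_def by force
    then obtain e where e: "e \<in> A" "ancestor (TopArc i j) e"
      unfolding descendants_def by blast
    then show ?thesis by (cases e) (auto simp: ext_top_def)
  qed
  have bot: "\<exists>e\<in>ext_bot A. i < e \<and> e < j" if "BotArc i j \<in> A" for i j
  proof -
    have "descendants A (BotArc i j) \<noteq> {}"
      using nss that unfolding no_secondary_segments_def by force
    then obtain e where e: "e \<in> A" "ancestor (BotArc i j) e"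
      unfolding descendants_def by blast
    then show ?thesis by (cases e) (auto simp: ext_bot_def)
  qed
  have row_top: "row n (ext_top A) (tops A)"
  proof (rule rowI)
    show "ext_top A \<union> fst ` tops A \<union> snd ` tops A = {1..n}"
    proof (intro equalityI subsetI)
      fix x assume "x \<in> ext_top A \<union> fst ` tops A \<union> snd ` tops A"
      then obtain a where "a \<in> A" "VR x \<in> endpoints a"
        by (fastforce simp: ext_top_def tops_def)
      then show "x \<in> {1..n}" using sub[of a] by (auto simp: vertices_def)
    next
      fix x assume "x \<in> {1..n}"
      then obtain a where a: "a \<in> A" "VR x \<in> endpoints a"
        using cover[of "VR x"] by (auto simp: vertices_def)
      then show "x \<in> ext_top A \<union> fst ` tops A \<union> snd ` tops A"
        by (cases a) (force simp: ext_top_def tops_def)+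
    qed
    have "\<not> (ExtArc x y \<in> A \<and> (TopArc x j \<in> A \<or> TopArc j x \<in> A))" for x y j
      using U[of "ExtArc x y" "TopArc x j" "VR x"] U[of "ExtArc x y" "TopArc j x" "VR x"] by auto
    then show "ext_top A \<inter> fst ` tops A = {}" "ext_top A \<inter> snd ` tops A = {}"
      by (auto simp: ext_top_def tops_def)
    show "fst ` tops A \<inter> snd ` tops A = {}"
    proof -
      have False if "TopArc i j \<in> A" "TopArc k i \<in> A" for i j k
        using U[OF that, of "VR i"] top[OF that(1)] by auto
      then show ?thesis by (auto simp: tops_def)
    qed
    show "j = l" if "(i, j) \<in> tops A" "(i, l) \<in> tops A" for i j l
      using U[of "TopArc i j" "TopArc i l" "VR i"] that by (auto simp: tops_def)
    show "j = l" if "(j, i) \<in> tops A" "(l, i) \<in> tops A" for i j l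
      using U[of "TopArc j i" "TopArc l i" "VR i"] that by (auto simp: tops_def)
    show "\<exists>e\<in>ext_top A. i < e \<and> e < j" if "(i, j) \<in> tops A" for i j
      using top that by (auto simp: tops_def)
    show "\<not> (i < k \<and> k < j \<and> j < l)" if "(i, j) \<in> tops A" "(k, l) \<in> tops A" for i j k l
      using pre that unfolding pre_structure_def tops_def by blast
    show "(i + 1, j - 1) \<notin> tops A" if "(i, j) \<in> tops A" for i j
      using shape_no_stack(1)[OF sh, of i j] that by (simp add: tops_def)
  qed
  have row_bot: "row m (ext_bot A) (bots A)"
  proof (rule rowI)
    show "ext_bot A \<union> fst ` bots A \<union> snd ` bots A = {1..m}"
    proof (intro equalityI subsetI)
      fix x assume "x \<in> ext_bot A \<union> fst ` bots A \<union> snd ` bots A"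
      then obtain a where "a \<in> A" "VS x \<in> endpoints a"
        by (fastforce simp: ext_bot_def bots_def)
      then show "x \<in> {1..m}" using sub[of a] by (auto simp: vertices_def)
    next
      fix x assume "x \<in> {1..m}"
      then obtain a where a: "a \<in> A" "VS x \<in> endpoints a"
        using cover[of "VS x"] by (auto simp: vertices_def)
      then show "x \<in> ext_bot A \<union> fst ` bots A \<union> snd ` bots A"
        by (cases a) (force simp: ext_bot_def bots_def)+
    qed
    have "\<not> (ExtArc y x \<in> A \<and> (BotArc x j \<in> A \<or> BotArc j x \<in> A))" for x y j
      using U[of "ExtArc y x" "BotArc x j" "VS x"] U[of "ExtArc y x" "BotArc j x" "VS x"] by auto
    then show "ext_bot A \<inter> fst ` bots A = {}" "ext_bot A \<inter> snd ` bots A = {}"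
      by (auto simp: ext_bot_def bots_def)
    show "fst ` bots A \<inter> snd ` bots A = {}"
    proof -
      have False if "BotArc i j \<in> A" "BotArc k i \<in> A" for i j k
        using U[OF that, of "VS i"] bot[OF that(1)] by auto
      then show ?thesis by (auto simp: bots_def)
    qed
    show "j = l" if "(i, j) \<in> bots A" "(i, l) \<in> bots A" for i j l
      using U[of "BotArc i j" "BotArc i l" "VS i"] that by (auto simp: bots_def)
    show "j = l" if "(j, i) \<in> bots A" "(l, i) \<in> bots A" for i j l
      using U[of "BotArc j i" "BotArc l i" "VS i"] that by (auto simp: bots_def)
    show "\<exists>e\<in>ext_bot A. i < e \<and> e < j" if "(i, j) \<in> bots A" for i j
      using bot that by (auto simp: bots_def)
    show "\<not> (i < k \<and> k < j \<and> j < l)" if "(i, j) \<in> bots A" "(k, l) \<in> bots A" for i j k l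
      using pre that unfolding pre_structure_def bots_def by blast
    show "(i + 1, j - 1) \<notin> bots A" if "(i, j) \<in> bots A" for i j
      using shape_no_stack(2)[OF sh, of i j] that by (simp add: bots_def)
  qed
  define X where "X = {(k, k'). ExtArc k k' \<in> A}"
  have fst_inj: "inj_on fst X"
  proof (rule inj_onI)
    fix p q assume "p \<in> X" "q \<in> X" "fst p = fst q"
    then show "p = q"
      using U[of "ExtArc (fst p) (snd p)" "ExtArc (fst q) (snd q)" "VR (fst p)"] by (auto simp: X_def)
  qed
  have snd_inj: "inj_on snd X"
  proof (rule inj_onI)
    fix p q assume "p \<in> X" "q \<in> X" "snd p = snd q"
    then show "p = q"
      using U[of "ExtArc (fst p) (snd p)" "ExtArc (fst q) (snd q)" "VS (snd p)"] by (auto simp: X_def)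
  qed
  have imgs: "ext_top A = fst ` X" "ext_bot A = snd ` X"
    by (force simp: ext_top_def ext_bot_def X_def)+
  have card: "card (ext_top A) = card (ext_bot A)"
    using card_image[OF fst_inj] card_image[OF snd_inj] by (simp add: imgs)
  have same: "before (ext_top A) k = before (ext_bot A) k'" if kk: "(k, k') \<in> X" for k k'
  proof -
    have cross: "l < k \<longleftrightarrow> l' < k'" if "(l, l') \<in> X" for l l'
    proof -
      have "\<not> (l < k \<and> k' < l')" "\<not> (k < l \<and> l' < k')"
        using pre kk that unfolding pre_structure_def X_def by blast+
      moreover have "l = k \<longleftrightarrow> l' = k'"
        using inj_onD[OF fst_inj _ kk that] inj_onD[OF snd_inj _ kk that] by auto
      ultimately show ?thesis by linarith
    qed
    define Y where "Y = {p \<in> X. fst p < k}"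
    have "{e \<in> ext_top A. e < k} = fst ` Y" by (auto simp: imgs Y_def)
    moreover have "{e \<in> ext_bot A. e < k'} = snd ` Y"
      using cross by (force simp: imgs Y_def)
    moreover have "card (fst ` Y) = card (snd ` Y)"
      using card_image[OF inj_on_subset[OF fst_inj, of Y]] card_image[OF inj_on_subset[OF snd_inj, of Y]]
      by (simp add: Y_def)
    ultimately show ?thesis by (simp add: before_def)
  qed
  have "ExtArc k k' \<in> A \<longleftrightarrow>
      k \<in> ext_top A \<and> k' \<in> ext_bot A \<and> before (ext_top A) k = before (ext_bot A) k'" for k k'
  proof
    assume "ExtArc k k' \<in> A"
    then show "k \<in> ext_top A \<and> k' \<in> ext_bot A \<and> before (ext_top A) k = before (ext_bot A) k'"
      using same[of k k'] by (auto simp: X_def ext_top_def ext_bot_def)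
  next
    assume *: "k \<in> ext_top A \<and> k' \<in> ext_bot A \<and> before (ext_top A) k = before (ext_bot A) k'"
    then obtain l where l: "ExtArc k l \<in> A" by (auto simp: ext_top_def)
    then have "l \<in> ext_bot A" "before (ext_bot A) l = before (ext_bot A) k'"
      using same[of k l] * by (auto simp: X_def ext_bot_def)
    then have "l = k'"
      using inj_onD[OF before_inj[OF row_facts(1)[OF row_bot]]] * by blast
    then show "ExtArc k k' \<in> A" using l by simp
  qed
  then show ?thesis unfolding matched_rows_def using row_top row_bot card by blast
qed

lemma ancestor_iff:
  "ancestor a e \<longleftrightarrow> (\<exists>i j k k'. e = ExtArc k k' \<and>
     ((a = TopArc i j \<and> i < k \<and> k < j) \<or> (a = BotArc i j \<and> i < k' \<and> k' < j)))"
  by (cases a; cases e) auto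

lemma before_Suc: "finite E \<Longrightarrow> before E (Suc i) = before E i + (if i \<in> E then 1 else 0)"
proof -
  assume fin: "finite E"
  have "{e \<in> E. e < Suc i} = {e \<in> E. e < i} \<union> (if i \<in> E then {i} else {})"
    by (auto simp: less_Suc_eq)
  then show ?thesis using fin unfolding before_def by (auto simp: card_insert_if)
qed

lemma row_no_stack:
  assumes "row n E P" "(i, j) \<in> P"
  shows "(i + 1, j - 1) \<notin> P"
proof
  assume ij': "(i + 1, j - 1) \<in> P"
  note R = row_facts[OF assms(1)]
  have j: "0 < j" using R(8)[OF assms(2)] by auto
  have "i \<in> fst ` P" "j - 1 \<in> snd ` P" using assms(2) ij' by (metis fst_conv snd_conv imageI)+
  then have "i \<notin> E" "j - 1 \<notin> E" using R(3,4) by blast+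
  then have "ext_span E (i, j) = ext_span E (i + 1, j - 1)"
    using before_Suc[OF R(1), of i] before_Suc[OF R(1), of "j - 1"] j by simp
  from inj_onD[OF R(10) this assms(2) ij'] show False by simp
qed

lemma matched_rows_pre:
  assumes mr: "matched_rows n m A"
  shows "pre_structure n m A" "no_secondary_segments n m A" "interior_stack A i j l \<Longrightarrow> l = 1"
proof -
  let ?E = "ext_top A" and ?E' = "ext_bot A"
  have rT: "row n ?E (tops A)" and rB: "row m ?E' (bots A)"
    and M: "\<And>k k'. ExtArc k k' \<in> A \<longleftrightarrow> k \<in> ?E \<and> k' \<in> ?E' \<and> before ?E k = before ?E' k'"
    and card: "card ?E = card ?E'"
    using mr unfolding matched_rows_def by blast+
  note T = row_facts[OF rT] and B = row_facts[OF rB]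
  have memT: "(i, j) \<in> tops A \<longleftrightarrow> TopArc i j \<in> A" and memB: "(i, j) \<in> bots A \<longleftrightarrow> BotArc i j \<in> A" for i j
    by (auto simp: tops_def bots_def)
  have Tv: "i \<in> {1..n}" "j \<in> {1..n}" "i \<notin> ?E" "j \<notin> ?E" "i < j" if ij: "TopArc i j \<in> A" for i j
  proof -
    have m: "i \<in> fst ` tops A" "j \<in> snd ` tops A" using ij unfolding memT[symmetric] by force+
    show "i \<in> {1..n}" "j \<in> {1..n}" unfolding T(2)[symmetric] using m by blast+
    show "i \<notin> ?E" "j \<notin> ?E" using m T(3,4) by blast+
    show "i < j" using T(8)[of i j] ij unfolding memT by auto
  qed
  have Bv: "i \<in> {1..m}" "j \<in> {1..m}" "i \<notin> ?E'" "j \<notin> ?E'" "i < j" if ij: "BotArc i j \<in> A" for i j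
  proof -
    have m: "i \<in> fst ` bots A" "j \<in> snd ` bots A" using ij unfolding memB[symmetric] by force+
    show "i \<in> {1..m}" "j \<in> {1..m}" unfolding B(2)[symmetric] using m by blast+
    show "i \<notin> ?E'" "j \<notin> ?E'" using m B(3,4) by blast+
    show "i < j" using B(8)[of i j] ij unfolding memB by auto
  qed
  have Ev: "k \<in> {1..n}" "k' \<in> {1..m}" "k \<in> ?E" "k' \<in> ?E'" if "ExtArc k k' \<in> A" for k k'
    using that T(2) B(2) unfolding M by blast+
  have TT: "i \<noteq> l" if "TopArc i j \<in> A" "TopArc k l \<in> A" for i j k l
    using that T(5) unfolding memT[symmetric] by force
  have BB: "i \<noteq> l" if "BotArc i j \<in> A" "BotArc k l \<in> A" for i j k l
    using that B(5) unfolding memB[symmetric] by force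
  have EE: "k = l \<longleftrightarrow> k' = l'" if "ExtArc k k' \<in> A" "ExtArc l l' \<in> A" for k k' l l'
    using that inj_onD[OF before_inj[OF T(1)]] inj_onD[OF before_inj[OF B(1)]] unfolding M by metis
  have TE: "k \<noteq> i \<and> k \<noteq> j" if "ExtArc k k' \<in> A" "TopArc i j \<in> A" for i j k k'
    using Tv(3,4)[OF that(2)] Ev(3)[OF that(1)] by blast
  have BE: "k' \<noteq> i \<and> k' \<noteq> j" if "ExtArc k k' \<in> A" "BotArc i j \<in> A" for i j k k'
    using Bv(3,4)[OF that(2)] Ev(4)[OF that(1)] by blast
  show "pre_structure n m A"
    unfolding pre_structure_def
  proof (intro conjI)
    show "\<forall>a\<in>A. endpoints a \<subseteq> vertices n m"
    proof
      fix a assume "a \<in> A"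
      then show "endpoints a \<subseteq> vertices n m"
        using Tv(1,2) Bv(1,2) Ev(1,2) by (cases a) (simp_all add: vertices_def)
    qed
    show "\<forall>i j. TopArc i j \<in> A \<longrightarrow> i < j" "\<forall>i j. BotArc i j \<in> A \<longrightarrow> i < j"
      using Tv Bv by blast+
    show "\<forall>a\<in>A. \<forall>b\<in>A. endpoints a \<inter> endpoints b \<noteq> {} \<longrightarrow> a = b"
    proof (intro ballI impI)
      fix a b assume ab: "a \<in> A" "b \<in> A" "endpoints a \<inter> endpoints b \<noteq> {}"
      show "a = b"
      proof (cases a)
        case (TopArc i j)
        show ?thesis
        proof (cases b)
          case b: (TopArc k l)
          have "i = k \<or> j = l"
            using ab TT[of i j k l] TT[of k l i j] unfolding TopArc b by auto
          then show ?thesis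
            using ab T(6)[of i j l] T(7)[of i j k] unfolding TopArc b memT by blast
        qed (use ab TopArc in \<open>auto dest: TE\<close>)
      next
        case (BotArc i j)
        show ?thesis
        proof (cases b)
          case b: (BotArc k l)
          have "i = k \<or> j = l"
            using ab BB[of i j k l] BB[of k l i j] unfolding BotArc b by auto
          then show ?thesis
            using ab B(6)[of i j l] B(7)[of i j k] unfolding BotArc b memB by blast
        qed (use ab BotArc in \<open>auto dest: BE\<close>)
      next
        case (ExtArc k k')
        show ?thesis
        proof (cases b)
          case b: (ExtArc l l')
          show ?thesis using ab EE[of k k' l l'] unfolding ExtArc b by auto
        qed (use ab ExtArc in \<open>auto dest: TE BE\<close>)
      qed
    qed
    show "\<not> (\<exists>i j k l. TopArc i j \<in> A \<and> TopArc k l \<in> A \<and> i < k \<and> k < j \<and> j < l)"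
      using T(9) unfolding memT by blast
    show "\<not> (\<exists>i j k l. BotArc i j \<in> A \<and> BotArc k l \<in> A \<and> i < k \<and> k < j \<and> j < l)"
      using B(9) unfolding memB by blast
    show "\<not> (\<exists>k k' l l'. ExtArc k k' \<in> A \<and> ExtArc l l' \<in> A \<and> k < l \<and> k' > l')"
    proof (intro notI, elim exE conjE)
      fix k k' l l' assume kl: "ExtArc k k' \<in> A" "ExtArc l l' \<in> A" "k < l" "l' < k'"
      have "before ?E k < before ?E l" "before ?E' l' < before ?E' k'"
        using before_less_iff[OF T(1), of k l] before_less_iff[OF B(1), of l' k'] kl Ev(3,4) by blast+
      then show False using kl(1,2) unfolding M by simp
    qed
  qed
  have onto: "\<exists>k'. ExtArc k k' \<in> A" if "k \<in> ?E" for k using that by (simp add: ext_top_def)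
  have onto': "\<exists>k. ExtArc k k' \<in> A" if "k' \<in> ?E'" for k' using that by (simp add: ext_bot_def)
  show "no_secondary_segments n m A"
    unfolding no_secondary_segments_def
  proof (intro conjI ballI impI)
    fix x assume x: "x \<in> vertices n m"
    show "\<exists>a\<in>A. x \<in> endpoints a"
    proof (cases x)
      case (VR i)
      then have "i \<in> ?E \<union> fst ` tops A \<union> snd ` tops A" unfolding T(2) using x
        by (auto simp: vertices_def)
      then consider k' where "ExtArc i k' \<in> A" | j where "TopArc i j \<in> A" | j where "TopArc j i \<in> A"
        using onto[of i] by (auto simp: tops_def)
      then show ?thesis unfolding VR by cases force+
    next
      case (VS i)
      then have "i \<in> ?E' \<union> fst ` bots A \<union> snd ` bots A" unfolding B(2) using x
        by (auto simp: vertices_def)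
      then consider k where "ExtArc k i \<in> A" | j where "BotArc i j \<in> A" | j where "BotArc j i \<in> A"
        using onto'[of i] by (auto simp: bots_def)
      then show ?thesis unfolding VS by cases force+
    qed
  next
    fix a assume a: "a \<in> A" "is_top a \<or> is_bot a"
    show "descendants A a \<noteq> {}"
    proof (cases a)
      case (TopArc i j)
      then obtain k k' where "ExtArc k k' \<in> A" "i < k" "k < j"
        using T(8)[of i j] a onto unfolding memT by blast
      then have "ExtArc k k' \<in> descendants A a" by (simp add: descendants_def TopArc)
      then show ?thesis by blast
    next
      case (BotArc i j)
      then obtain k k' where "ExtArc k k' \<in> A" "i < k'" "k' < j"
        using B(8)[of i j] a onto' unfolding memB by blast
      then have "ExtArc k k' \<in> descendants A a" by (simp add: descendants_def BotArc)
      then show ?thesis by blast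
    qed (use a in simp)
  qed
  show "l = 1" if st: "interior_stack A i j l"
  proof (rule ccontr)
    assume "l \<noteq> 1"
    moreover have "0 < l" using st unfolding interior_stack_def maximal_seq_def by blast
    ultimately have l: "0 < l" "1 < l" by auto
    have "(\<forall>s<l. TopArc (i + s) (j - s) \<in> A) \<or> (\<forall>s<l. BotArc (i + s) (j - s) \<in> A)"
      using st unfolding interior_stack_def maximal_seq_def top_seq_def bot_seq_def image_subset_iff
        lessThan_iff Ball_def by blast
    then have "(TopArc (i + 0) (j - 0) \<in> A \<and> TopArc (i + 1) (j - 1) \<in> A) \<or>
        (BotArc (i + 0) (j - 0) \<in> A \<and> BotArc (i + 1) (j - 1) \<in> A)"
      using l by blast
    then have "(TopArc i j \<in> A \<and> TopArc (i + 1) (j - 1) \<in> A) \<or>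
        (BotArc i j \<in> A \<and> BotArc (i + 1) (j - 1) \<in> A)"
      by simp
    then show False
      using row_no_stack[OF rT, of i j] row_no_stack[OF rB, of i j] unfolding memT memB by blast
  qed
qed

lemma matched_rows_ext_index:
  assumes mr: "matched_rows n m A"
  obtains e where "inj_on e {..<card (ext_top A)}"
    "\<And>i j. TopArc i j \<in> A \<Longrightarrow> descendants A (TopArc i j) =
        e ` {before (ext_top A) i..<before (ext_top A) j}"
    "\<And>i j. BotArc i j \<in> A \<Longrightarrow> descendants A (BotArc i j) =
        e ` {before (ext_bot A) i..<before (ext_bot A) j}"
    "\<And>r. r < card (ext_top A) \<Longrightarrow> \<exists>k k'. e r = ExtArc k k' \<and> ExtArc k k' \<in> A \<and>
        before (ext_top A) k = r \<and> before (ext_bot A) k' = r"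
proof -
  let ?E = "ext_top A" and ?E' = "ext_bot A"
  have rT: "row n ?E (tops A)" and rB: "row m ?E' (bots A)"
    and M: "\<And>k k'. ExtArc k k' \<in> A \<longleftrightarrow> k \<in> ?E \<and> k' \<in> ?E' \<and> before ?E k = before ?E' k'"
    and card: "card ?E = card ?E'"
    using mr unfolding matched_rows_def by blast+
  note T = row_facts[OF rT] and B = row_facts[OF rB]
  define e where "e r = ExtArc (inv_into ?E (before ?E) r) (inv_into ?E' (before ?E') r)" for r
  have e: "\<exists>k k'. e r = ExtArc k k' \<and> ExtArc k k' \<in> A \<and> before ?E k = r \<and> before ?E' k' = r"
    if "r < card ?E" for r
  proof -
    have "r \<in> before ?E ` ?E" "r \<in> before ?E' ` ?E'"
      using that card before_image[OF T(1)] before_image[OF B(1)] by auto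
    from inv_into_into[OF this(1)] inv_into_into[OF this(2)] f_inv_into_f[OF this(1)] f_inv_into_f[OF this(2)]
    show ?thesis unfolding e_def M by auto
  qed
  have idx: "ExtArc k k' = e (before ?E k)" if kk: "ExtArc k k' \<in> A" for k k'
  proof -
    have kk': "k \<in> ?E" "k' \<in> ?E'" "before ?E k = before ?E' k'" using kk unfolding M by auto
    have "inv_into ?E (before ?E) (before ?E k) = k"
      by (rule inv_into_f_f[OF before_inj[OF T(1)] kk'(1)])
    moreover have "inv_into ?E' (before ?E') (before ?E k) = k'"
      unfolding kk'(3) by (rule inv_into_f_f[OF before_inj[OF B(1)] kk'(2)])
    ultimately show ?thesis by (simp only: e_def)
  qed
  have inj: "inj_on e {..<card ?E}"
  proof (rule inj_onI)
    fix r s assume "r \<in> {..<card ?E}" "s \<in> {..<card ?E}" "e r = e s"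
    then show "r = s" using e[of r] e[of s] by auto
  qed
  have rank: "before ?E' k' = before ?E k" if "ExtArc k k' \<in> A" for k k'
    using that unfolding M by simp
  have top: "descendants A (TopArc i j) = e ` {before ?E i..<before ?E j}" if ij: "TopArc i j \<in> A" for i j
  proof -
    have "ExtArc k k' \<in> e ` {before ?E i..<before ?E j}" if "ExtArc k k' \<in> A" "i < k" "k < j" for k k'
      using that idx row_under_iff[OF rT, of i j k] ij by (auto simp: M tops_def)
    moreover have "\<exists>k k'. e r = ExtArc k k' \<and> ExtArc k k' \<in> A \<and> i < k \<and> k < j"
      if r: "before ?E i \<le> r" "r < before ?E j" for r
    proof -
      have "r < card ?E" using r before_le[OF T(1), of j] by simp
      from e[OF this] obtain k k' where k: "e r = ExtArc k k'" "ExtArc k k' \<in> A" "before ?E k = r" by blast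
      have "i < k \<and> k < j" using row_under_iff[OF rT, of i j k] ij k r by (auto simp: M tops_def)
      then show ?thesis using k by blast
    qed
    ultimately show ?thesis
    proof (intro equalityI subsetI, goal_cases)
      case (1 a)
      then show ?case unfolding descendants_def ancestor_iff by blast
    next
      case (2 a)
      then obtain r where "a = e r" "before ?E i \<le> r" "r < before ?E j" by auto
      with 2(2)[of r] show ?case by (auto simp: descendants_def)
    qed
  qed
  have bot: "descendants A (BotArc i j) = e ` {before ?E' i..<before ?E' j}" if ij: "BotArc i j \<in> A" for i j
  proof -
    have "ExtArc k k' \<in> e ` {before ?E' i..<before ?E' j}" if kk: "ExtArc k k' \<in> A" "i < k'" "k' < j" for k k'
    proof -
      have "k' \<in> ?E'" using kk(1) unfolding M by simp
      then have "before ?E k \<in> {before ?E' i..<before ?E' j}"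
        using row_under_iff[OF rB, of i j k'] ij kk(2,3) rank[OF kk(1)] by (simp add: bots_def)
      then show ?thesis unfolding idx[OF kk(1)] by (rule imageI)
    qed
    moreover have "\<exists>k k'. e r = ExtArc k k' \<and> ExtArc k k' \<in> A \<and> i < k' \<and> k' < j"
      if r: "before ?E' i \<le> r" "r < before ?E' j" for r
    proof -
      have "r < card ?E" using r before_le[OF B(1), of j] card by simp
      from e[OF this] obtain k k' where k: "e r = ExtArc k k'" "ExtArc k k' \<in> A" "before ?E' k' = r" by blast
      have "i < k' \<and> k' < j" using row_under_iff[OF rB, of i j k'] ij k r by (auto simp: M bots_def)
      then show ?thesis using k by blast
    qed
    ultimately show ?thesis
    proof (intro equalityI subsetI, goal_cases)
      case (1 a)
      then show ?case unfolding descendants_def ancestor_iff by blast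
    next
      case (2 a)
      then obtain r where "a = e r" "before ?E' i \<le> r" "r < before ?E' j" by auto
      with 2(2)[of r] show ?case by (auto simp: descendants_def)
    qed
  qed
  show ?thesis by (rule that[OF inj top bot e])
qed

lemma matched_rows_zigzag_iff:
  assumes mr: "matched_rows n m A"
  shows "(\<exists>a b. zigzag A a b) \<longleftrightarrow> \<not> laminar (top_spans A \<union> bot_spans A)"
proof -
  let ?c = "before (ext_top A)" and ?c' = "before (ext_bot A)"
  have rT: "row n (ext_top A) (tops A)" and rB: "row m (ext_bot A) (bots A)"
    and card: "card (ext_top A) = card (ext_bot A)"
    using mr unfolding matched_rows_def by blast+
  obtain e where inj: "inj_on e {..<card (ext_top A)}"
    and top: "\<And>i j. TopArc i j \<in> A \<Longrightarrow> descendants A (TopArc i j) = e ` {?c i..<?c j}"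
    and bot: "\<And>i j. BotArc i j \<in> A \<Longrightarrow> descendants A (BotArc i j) = e ` {?c' i..<?c' j}"
    using matched_rows_ext_index[OF mr] by metis
  define C where "C a b c d \<longleftrightarrow> b \<le> c \<or> d \<le> a \<or> (a \<le> c \<and> d \<le> b) \<or> (c \<le> a \<and> b \<le> d)" for a b c d :: nat
  have zz: "zigzag A (TopArc i j) (BotArc k l) \<longleftrightarrow> \<not> C (?c i) (?c j) (?c' k) (?c' l)"
    if ij: "TopArc i j \<in> A" and kl: "BotArc k l \<in> A" for i j k l
  proof -
    have I: "?c i < ?c j" "?c j \<le> card (ext_top A)" "?c' k < ?c' l" "?c' l \<le> card (ext_top A)"
      using subsetD[OF row_spans(1)[OF rT] imageI, of "(i, j)"]
        subsetD[OF row_spans(1)[OF rB] imageI, of "(k, l)"] ij kl card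
      by (auto simp: tops_def bots_def intervals_def)
    let ?I = "{?c i..<?c j}" and ?J = "{?c' k..<?c' l}"
    have sub: "?I \<subseteq> {..<card (ext_top A)}" "?J \<subseteq> {..<card (ext_top A)}" using I by auto
    have subset_iff: "e ` X \<subseteq> e ` Y \<longleftrightarrow> X \<subseteq> Y"
      if "X \<subseteq> {..<card (ext_top A)}" "Y \<subseteq> {..<card (ext_top A)}" for X Y
      using inj_on_image_mem_iff[OF inj _ that(2)] that(1) by blast
    have "zigzag A (TopArc i j) (BotArc k l) \<longleftrightarrow> ?I \<inter> ?J \<noteq> {} \<and> \<not> ?J \<subseteq> ?I \<and> \<not> ?I \<subseteq> ?J"
      unfolding zigzag_def dependent_arcs_def subsumes_def top[OF ij] bot[OF kl]
      using ij kl inj_on_image_Int[OF inj sub] subset_iff[OF sub] subset_iff[OF sub(2,1)] by auto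
    also have "\<dots> \<longleftrightarrow> \<not> C (?c i) (?c j) (?c' k) (?c' l)"
      using I unfolding C_def by (auto simp: atLeastLessThan_subset_iff)
    finally show ?thesis .
  qed
  have zz': "(\<exists>a b. zigzag A a b) \<longleftrightarrow>
      (\<exists>i j k l. TopArc i j \<in> A \<and> BotArc k l \<in> A \<and> zigzag A (TopArc i j) (BotArc k l))"
  proof
    assume "\<exists>a b. zigzag A a b"
    then obtain a b where ab: "zigzag A a b" by blast
    then have "a \<in> A" "b \<in> A" "is_top a" "is_bot b" unfolding zigzag_def by auto
    with ab show "\<exists>i j k l. TopArc i j \<in> A \<and> BotArc k l \<in> A \<and> zigzag A (TopArc i j) (BotArc k l)"
      by (cases a; cases b) auto
  qed blast
  have sym: "C a b c d \<longleftrightarrow> C c d a b" for a b c d unfolding C_def by auto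
  have lT: "\<forall>(a, b)\<in>top_spans A. \<forall>(c, d)\<in>top_spans A. C a b c d"
    and lB: "\<forall>(a, b)\<in>bot_spans A. \<forall>(c, d)\<in>bot_spans A. C a b c d"
    using row_spans(2)[OF rT] row_spans(2)[OF rB]
    unfolding laminar_def C_def top_spans_def bot_spans_def by blast+
  have "laminar (top_spans A \<union> bot_spans A) \<longleftrightarrow>
      (\<forall>(a, b)\<in>top_spans A. \<forall>(c, d)\<in>bot_spans A. C a b c d)"
  proof
    assume "laminar (top_spans A \<union> bot_spans A)"
    then show "\<forall>(a, b)\<in>top_spans A. \<forall>(c, d)\<in>bot_spans A. C a b c d"
      unfolding laminar_def C_def by blast
  next
    assume *: "\<forall>(a, b)\<in>top_spans A. \<forall>(c, d)\<in>bot_spans A. C a b c d"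
    have "C a b c d" if "(a, b) \<in> top_spans A \<union> bot_spans A" "(c, d) \<in> top_spans A \<union> bot_spans A" for a b c d
      using that lT lB * sym[of a b c d] by blast
    then show "laminar (top_spans A \<union> bot_spans A)" unfolding laminar_def C_def by blast
  qed
  also have "\<dots> \<longleftrightarrow> (\<forall>i j k l. TopArc i j \<in> A \<longrightarrow> BotArc k l \<in> A \<longrightarrow> C (?c i) (?c j) (?c' k) (?c' l))"
    by (auto simp: top_spans_def bot_spans_def tops_def bots_def)
  finally show ?thesis using zz zz' by blast
qed

lemma matched_rows_ext_adjacent_iff:
  assumes mr: "matched_rows n m A"
  shows "(\<exists>k k'. ExtArc k k' \<in> A \<and> ExtArc (k + 1) (k' + 1) \<in> A) \<longleftrightarrow>
    \<not> separated (card (ext_top A)) (top_spans A \<union> bot_spans A)"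
proof -
  let ?E = "ext_top A" and ?E' = "ext_bot A" and ?F = "top_spans A \<union> bot_spans A"
  have rT: "row n ?E (tops A)" and rB: "row m ?E' (bots A)"
    and M: "\<And>k k'. ExtArc k k' \<in> A \<longleftrightarrow> k \<in> ?E \<and> k' \<in> ?E' \<and> before ?E k = before ?E' k'"
    using mr unfolding matched_rows_def by blast+
  note T = row_facts[OF rT] and B = row_facts[OF rB]
  have adj: "l = k + 1 \<and> l' = k' + 1 \<longleftrightarrow> \<not> (\<exists>x. (x, before ?E l) \<in> ?F \<or> (before ?E l, x) \<in> ?F)"
    if kk: "ExtArc k k' \<in> A" and ll: "ExtArc l l' \<in> A" and s: "before ?E l = Suc (before ?E k)" for k k' l l'
    using kk ll row_adjacent[OF rT _ _ s] row_adjacent[OF rB, of k' l'] s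
    unfolding M top_spans_def bot_spans_def by auto
  show ?thesis
  proof
    assume "\<exists>k k'. ExtArc k k' \<in> A \<and> ExtArc (k + 1) (k' + 1) \<in> A"
    then obtain k k' where k: "ExtArc k k' \<in> A" "ExtArc (k + 1) (k' + 1) \<in> A" by blast
    then have s: "before ?E (k + 1) = Suc (before ?E k)"
      using before_Suc[OF T(1), of k] unfolding M by simp
    moreover have "before ?E (k + 1) < card ?E" using k(2) before_image[OF T(1)] unfolding M by blast
    ultimately show "\<not> separated (card ?E) ?F"
      using adj[OF k s] unfolding separated_def by (metis zero_less_Suc)
  next
    assume "\<not> separated (card ?E) ?F"
    then obtain g where g: "0 < g" "g < card ?E" "\<not> (\<exists>x. (x, g) \<in> ?F \<or> (g, x) \<in> ?F)"
      unfolding separated_def by blast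
    obtain e where e: "\<And>r. r < card ?E \<Longrightarrow> \<exists>k k'. e r = ExtArc k k' \<and> ExtArc k k' \<in> A \<and>
        before ?E k = r \<and> before ?E' k' = r"
      using matched_rows_ext_index[OF mr] by metis
    obtain k k' where k: "ExtArc k k' \<in> A" "before ?E k = g - 1" using e[of "g - 1"] g(2) by (meson less_imp_diff_less)
    obtain l l' where l: "ExtArc l l' \<in> A" "before ?E l = g" using e[of g] g by auto
    have "l = k + 1 \<and> l' = k' + 1" using adj[OF k(1) l(1)] k(2) l(2) g by auto
    then show "\<exists>k k'. ExtArc k k' \<in> A \<and> ExtArc (k + 1) (k' + 1) \<in> A" using k l by blast
  qed
qed

lemma shape_iff:
  "shape n m A \<longleftrightarrow> matched_rows n m A \<and> laminar (top_spans A \<union> bot_spans A) \<and>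
     separated (card (ext_top A)) (top_spans A \<union> bot_spans A)"
proof (cases "matched_rows n m A")
  case mr: True
  show ?thesis
  proof
    assume sh: "shape n m A"
    have "\<not> (\<exists>k k'. ExtArc k k' \<in> A \<and> ExtArc (k + 1) (k' + 1) \<in> A)"
      using shape_no_stack(3)[OF sh] by blast
    moreover have "\<not> (\<exists>a b. zigzag A a b)"
      using sh unfolding shape_def joint_structure_def by blast
    ultimately show "matched_rows n m A \<and> laminar (top_spans A \<union> bot_spans A) \<and>
        separated (card (ext_top A)) (top_spans A \<union> bot_spans A)"
      using mr matched_rows_zigzag_iff[OF mr] matched_rows_ext_adjacent_iff[OF mr] by blast
  next
    assume *: "matched_rows n m A \<and> laminar (top_spans A \<union> bot_spans A) \<and>
        separated (card (ext_top A)) (top_spans A \<union> bot_spans A)"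
    have "l = 1" if st: "exterior_stack A i i' l" for i i' l
    proof (rule ccontr)
      assume "l \<noteq> 1"
      moreover have "0 < l" using st unfolding exterior_stack_def maximal_seq_def by blast
      ultimately have l: "0 < l" "1 < l" by auto
      have "\<forall>s<l. ExtArc (i + s) (i' + s) \<in> A"
        using st unfolding exterior_stack_def maximal_seq_def ext_seq_def image_subset_iff
          lessThan_iff Ball_def by blast
      then have "ExtArc (i + 0) (i' + 0) \<in> A \<and> ExtArc (i + 1) (i' + 1) \<in> A"
        using l by blast
      then have "ExtArc i i' \<in> A \<and> ExtArc (i + 1) (i' + 1) \<in> A" by simp
      then show False using matched_rows_ext_adjacent_iff[OF mr] * by blast
    qed
    then show "shape n m A"
      unfolding shape_def joint_structure_def
      using matched_rows_pre[OF mr] matched_rows_zigzag_iff[OF mr] * by blast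
  qed
qed (use shape_matched_rows in blast)

section \<open>Counting shapes\<close>

definition structure_of :: "nat \<Rightarrow> (nat \<times> nat) set \<Rightarrow> (nat \<times> nat) set \<Rightarrow> arc set" where
  "structure_of h T B = case_prod TopArc ` arcs_of h T \<union> case_prod BotArc ` arcs_of h B \<union>
     (\<lambda>r. ExtArc (pos h T (ekey r)) (pos h B (ekey r))) ` {..<h}"

lemma structure_of_parts:
  "tops (structure_of h T B) = arcs_of h T" "bots (structure_of h T B) = arcs_of h B"
  "ext_top (structure_of h T B) = ext_of h T" "ext_bot (structure_of h T B) = ext_of h B"
  by (auto simp: structure_of_def tops_def bots_def ext_top_def ext_bot_def ext_of_def)

lemma families_UnD:
  assumes "T \<union> B \<in> families h"
  shows "T \<subseteq> intervals h" "laminar T" "B \<subseteq> intervals h" "laminar B"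
  using assms unfolding families_def laminar_def by blast+

lemma structure_of_shape:
  assumes TB: "T \<union> B \<in> families h"
  defines "A \<equiv> structure_of h T B"
  shows "shape (card (keys h T)) (card (keys h B)) A"
    "top_spans A = T" "bot_spans A = B"
proof -
  note rT = row_exists[OF families_UnD(1,2)[OF TB]]
  note rB = row_exists[OF families_UnD(3,4)[OF TB]]
  note parts = structure_of_parts[of h T B, folded A_def]
  have M: "ExtArc k k' \<in> A \<longleftrightarrow>
      k \<in> ext_of h T \<and> k' \<in> ext_of h B \<and> before (ext_of h T) k = before (ext_of h B) k'" for k k'
  proof
    assume "ExtArc k k' \<in> A"
    then obtain r where "r < h" "k = pos h T (ekey r)" "k' = pos h B (ekey r)"
      by (auto simp: A_def structure_of_def)
    then show "k \<in> ext_of h T \<and> k' \<in> ext_of h B \<and> before (ext_of h T) k = before (ext_of h B) k'"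
      using rT(5) rB(5) by (simp add: ext_of_def)
  next
    assume *: "k \<in> ext_of h T \<and> k' \<in> ext_of h B \<and> before (ext_of h T) k = before (ext_of h B) k'"
    then obtain r s where rs: "r < h" "k = pos h T (ekey r)" "s < h" "k' = pos h B (ekey s)"
      by (auto simp: ext_of_def)
    then have "r = s" using * rT(5)[of r] rB(5)[of s] by simp
    then show "ExtArc k k' \<in> A" using rs by (auto simp: A_def structure_of_def)
  qed
  have mr: "matched_rows (card (keys h T)) (card (keys h B)) A"
    unfolding matched_rows_def parts using rT(1,2) rB(1,2) M by simp
  show T: "top_spans A = T" and B: "bot_spans A = B"
    unfolding top_spans_def bot_spans_def parts by (rule rT(3), rule rB(3))
  show "shape (card (keys h T)) (card (keys h B)) A"
    unfolding shape_iff T B parts rT(2) using mr TB by (simp add: families_def)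
qed

lemma shape_is_structure_of:
  assumes sh: "shape n m A"
  defines "h \<equiv> card (ext_top A)"
  shows "n = card (keys h (top_spans A))" "m = card (keys h (bot_spans A))"
    "A = structure_of h (top_spans A) (bot_spans A)"
    "top_spans A \<union> bot_spans A \<in> families h"
proof -
  let ?T = "top_spans A" and ?B = "bot_spans A"
  have mr: "matched_rows n m A" using sh shape_iff by blast
  then have rT: "row n (ext_top A) (tops A)" and rB: "row m (ext_bot A) (bots A)"
    and card: "card (ext_bot A) = h"
    and M: "\<And>k k'. ExtArc k k' \<in> A \<longleftrightarrow>
      k \<in> ext_top A \<and> k' \<in> ext_bot A \<and> before (ext_top A) k = before (ext_bot A) k'"
    unfolding matched_rows_def h_def by metis+
  note uT = row_unique[OF rT, folded top_spans_def h_def]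
  note uB = row_unique[OF rB, folded bot_spans_def, unfolded card]
  show "n = card (keys h ?T)" by (rule uT(1))
  show "m = card (keys h ?B)" by (rule uB(1))
  have sub: "?T \<subseteq> intervals h" "?B \<subseteq> intervals h"
    using row_spans(1)[OF rT] row_spans(1)[OF rB] card unfolding top_spans_def bot_spans_def h_def by simp_all
  then show fam: "?T \<union> ?B \<in> families h"
    using sh unfolding shape_iff families_def h_def by blast
  note rT' = row_exists[OF families_UnD(1,2)[OF fam]] and rB' = row_exists[OF families_UnD(3,4)[OF fam]]
  let ?S = "structure_of h ?T ?B"
  note parts = structure_of_parts[of h ?T ?B]
  have "a \<in> A \<longleftrightarrow> a \<in> ?S" for a
  proof (cases a)
    case (TopArc i j)
    have "(i, j) \<in> tops A \<longleftrightarrow> (i, j) \<in> tops ?S" unfolding parts uT(3)[symmetric] ..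
    then show ?thesis by (simp add: tops_def TopArc)
  next
    case (BotArc i j)
    have "(i, j) \<in> bots A \<longleftrightarrow> (i, j) \<in> bots ?S" unfolding parts uB(3)[symmetric] ..
    then show ?thesis by (simp add: bots_def BotArc)
  next
    case (ExtArc k k')
    have "ExtArc k k' \<in> A \<longleftrightarrow> (\<exists>r<h. k = pos h ?T (ekey r) \<and> k' = pos h ?B (ekey r))"
    proof
      assume kk: "ExtArc k k' \<in> A"
      then have *: "k \<in> ext_top A" "k' \<in> ext_bot A" "before (ext_top A) k = before (ext_bot A) k'"
        unfolding M by auto
      have "before (ext_top A) k < h"
        using *(1) before_image[OF row_facts(1)[OF rT]] unfolding h_def by blast
      moreover have "k = pos h ?T (ekey (before (ext_top A) k))" by (rule uT(4)[OF *(1)])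
      moreover have "k' = pos h ?B (ekey (before (ext_top A) k))"
        unfolding *(3) by (rule uB(4)[OF *(2)])
      ultimately show "\<exists>r<h. k = pos h ?T (ekey r) \<and> k' = pos h ?B (ekey r)" by blast
    next
      assume "\<exists>r<h. k = pos h ?T (ekey r) \<and> k' = pos h ?B (ekey r)"
      then obtain r where r: "r < h" "k = pos h ?T (ekey r)" "k' = pos h ?B (ekey r)" by blast
      have "k \<in> ext_of h ?T" "k' \<in> ext_of h ?B" using r by (auto simp: ext_of_def)
      then show "ExtArc k k' \<in> A"
        unfolding M uT(2)[symmetric] uB(2)[symmetric]
        using rT'(5)[OF r(1)] rB'(5)[OF r(1)] unfolding r(2,3) uT(2)[symmetric] uB(2)[symmetric] by simp
    qed
    also have "\<dots> \<longleftrightarrow> ExtArc k k' \<in> ?S" by (auto simp: structure_of_def)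
    finally show ?thesis by (simp only: ExtArc)
  qed
  then show "A = ?S" by blast
qed

lemma card_arcs:
  assumes sh: "shape n m A"
  shows "card {a \<in> A. is_top a} = card (top_spans A)" "card {a \<in> A. is_bot a} = card (bot_spans A)"
    "card {a \<in> A. is_ext a} = card (ext_top A)"
proof -
  have mr: "matched_rows n m A" using sh shape_iff by blast
  then have rT: "row n (ext_top A) (tops A)" and rB: "row m (ext_bot A) (bots A)"
    and M: "\<And>k k'. ExtArc k k' \<in> A \<longleftrightarrow>
      k \<in> ext_top A \<and> k' \<in> ext_bot A \<and> before (ext_top A) k = before (ext_bot A) k'"
    unfolding matched_rows_def by blast+
  have "is_top a \<longleftrightarrow> (\<exists>i j. a = TopArc i j)" for a by (cases a) auto
  then have "{a \<in> A. is_top a} = case_prod TopArc ` tops A" by (auto simp: tops_def image_iff)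
  moreover have "inj_on (case_prod TopArc) (tops A)" by (auto simp: inj_on_def)
  ultimately show "card {a \<in> A. is_top a} = card (top_spans A)"
    using row_facts(10)[OF rT] by (simp add: top_spans_def card_image)
  have "is_bot a \<longleftrightarrow> (\<exists>i j. a = BotArc i j)" for a by (cases a) auto
  then have "{a \<in> A. is_bot a} = case_prod BotArc ` bots A" by (auto simp: bots_def image_iff)
  moreover have "inj_on (case_prod BotArc) (bots A)" by (auto simp: inj_on_def)
  ultimately show "card {a \<in> A. is_bot a} = card (bot_spans A)"
    using row_facts(10)[OF rB] by (simp add: bot_spans_def card_image)
  define X where "X = {(k, k'). ExtArc k k' \<in> A}"
  have "is_ext a \<longleftrightarrow> (\<exists>k k'. a = ExtArc k k')" for a by (cases a) auto
  then have "{a \<in> A. is_ext a} = case_prod ExtArc ` X" by (auto simp: X_def image_iff)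
  moreover have "inj_on (case_prod ExtArc) X" by (auto simp: inj_on_def)
  ultimately have "card {a \<in> A. is_ext a} = card X" by (simp add: card_image)
  also have "inj_on fst X"
  proof (rule inj_onI)
    fix p q assume "p \<in> X" "q \<in> X" "fst p = fst q"
    then obtain k k' l' where pq: "p = (k, k')" "q = (k, l')" "ExtArc k k' \<in> A" "ExtArc k l' \<in> A"
      by (cases p; cases q) (auto simp: X_def)
    have "k' = l'"
      using inj_onD[OF before_inj[OF row_facts(1)[OF rB]], of k' l'] pq(3,4) unfolding M by simp
    then show "p = q" by (simp add: pq)
  qed
  then have "card X = card (fst ` X)" by (simp add: card_image)
  also have "fst ` X = ext_top A" by (force simp: X_def ext_top_def)
  finally show "card {a \<in> A. is_ext a} = card (ext_top A)" .
qed

definition coloured_families :: "nat \<Rightarrow> ((nat \<times> nat) set \<times> (nat \<times> nat) set) set" where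
  "coloured_families h = {(T, B). T \<union> B \<in> families h}"

lemma num_shapes_eq:
  "num_shapes t1 t2 h = card {(T, B) \<in> coloured_families h. card T = t1 \<and> card B = t2}"
proof -
  define f where "f = (\<lambda>(T, B). (card (keys h T), card (keys h B), structure_of h T B))"
  let ?D = "{(T, B) \<in> coloured_families h. card T = t1 \<and> card B = t2}"
  have inj: "inj_on f ?D"
  proof (rule inj_onI)
    fix p q assume p: "p \<in> ?D" and q: "q \<in> ?D" and eq: "f p = f q"
    obtain T B T' B' where pq: "p = (T, B)" "q = (T', B')" by (cases p; cases q) auto
    have TB: "T \<union> B \<in> families h" "T' \<union> B' \<in> families h"
      using p q by (auto simp: pq coloured_families_def)
    have "structure_of h T B = structure_of h T' B'" using eq by (simp add: f_def pq)
    then show "p = q"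
      using structure_of_shape(2,3)[OF TB(1)] structure_of_shape(2,3)[OF TB(2)] by (simp add: pq)
  qed
  have img: "f ` ?D = shapes t1 t2 h"
  proof (intro equalityI subsetI)
    fix x assume "x \<in> f ` ?D"
    then obtain T B where TB: "T \<union> B \<in> families h" "card T = t1" "card B = t2"
      and x: "x = (card (keys h T), card (keys h B), structure_of h T B)"
      by (auto simp: f_def coloured_families_def)
    note S = structure_of_shape[OF TB(1)]
    have "card (ext_top (structure_of h T B)) = h"
      unfolding structure_of_parts using row_exists(2)[OF families_UnD(1,2)[OF TB(1)]] .
    then show "x \<in> shapes t1 t2 h"
      unfolding x shapes_def using S TB(2,3) card_arcs[OF S(1)] by simp
  next
    fix x assume "x \<in> shapes t1 t2 h"
    then obtain n m A where x: "x = (n, m, A)" and sh: "shape n m A"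
      and c: "card {a \<in> A. is_top a} = t1" "card {a \<in> A. is_bot a} = t2" "card {a \<in> A. is_ext a} = h"
      unfolding shapes_def by blast
    have h: "card (ext_top A) = h" using c card_arcs[OF sh] by simp
    note S = shape_is_structure_of[OF sh, unfolded h]
    have "x = f (top_spans A, bot_spans A)" by (simp only: x f_def prod.case S(1-3)[symmetric])
    moreover have "(top_spans A, bot_spans A) \<in> ?D"
      using S(4) c card_arcs[OF sh] by (simp add: coloured_families_def)
    ultimately show "x \<in> f ` ?D" by blast
  qed
  show ?thesis unfolding num_shapes_def img[symmetric] by (rule card_image[OF inj])
qed

lemma sum_colourings:
  fixes u v :: "'a::comm_ring_1"
  assumes fin: "finite F"
  shows "(\<Sum>(T, B) | T \<union> B = F. u ^ card T * v ^ card B) = (u + v + u * v) ^ card F"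
proof -
  have "(u + v + u * v) ^ card F = (\<Prod>x\<in>F. u * (1 + v) + v)"
    by (simp add: algebra_simps)
  also have "\<dots> = (\<Sum>T\<in>Pow F. (u * (1 + v)) ^ card T * v ^ card (F - T))"
    unfolding prod_add[OF fin] by simp
  also have "\<dots> = (\<Sum>T\<in>Pow F. \<Sum>Y\<in>Pow T. u ^ card T * v ^ card (Y \<union> (F - T)))"
  proof (rule sum.cong[OF refl])
    fix T assume T: "T \<in> Pow F"
    then have finT: "finite T" using fin finite_subset by auto
    have "(1 + v) ^ card T = (\<Prod>x\<in>T. v + 1)" by (simp add: add.commute)
    also have "\<dots> = (\<Sum>Y\<in>Pow T. v ^ card Y)" unfolding prod_add[OF finT] by simp
    finally have "(u * (1 + v)) ^ card T * v ^ card (F - T) =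
        (\<Sum>Y\<in>Pow T. u ^ card T * (v ^ card Y * v ^ card (F - T)))"
      by (simp add: power_mult_distrib sum_distrib_left sum_distrib_right mult.assoc)
    also have "\<dots> = (\<Sum>Y\<in>Pow T. u ^ card T * v ^ card (Y \<union> (F - T)))"
    proof (rule sum.cong[OF refl])
      fix Y assume "Y \<in> Pow T"
      then have "card (Y \<union> (F - T)) = card Y + card (F - T)"
        using finT fin finite_subset by (subst card_Un_disjoint) auto
      then show "u ^ card T * (v ^ card Y * v ^ card (F - T)) = u ^ card T * v ^ card (Y \<union> (F - T))"
        by (simp add: power_add)
    qed
    finally show "(u * (1 + v)) ^ card T * v ^ card (F - T) =
        (\<Sum>Y\<in>Pow T. u ^ card T * v ^ card (Y \<union> (F - T)))" .
  qed
  also have "\<dots> = (\<Sum>(T, Y)\<in>Sigma (Pow F) Pow. u ^ card T * v ^ card (Y \<union> (F - T)))"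
    by (rule sum.Sigma) (use fin finite_subset in auto)
  also have "\<dots> = (\<Sum>(T, B) | T \<union> B = F. u ^ card T * v ^ card B)"
    by (rule sum.reindex_bij_witness[of _ "\<lambda>(T, B). (T, B \<inter> T)" "\<lambda>(T, Y). (T, Y \<union> (F - T))"]) auto
  finally show ?thesis by simp
qed

lemma shape_gf_eq_family_gf: "shape_gf = family_gf (fps_const fps_X + fps_X + fps_const fps_X * fps_X)"
proof (rule fps_ext)
  fix h
  let ?u = "fps_const fps_X :: int fps fps" and ?v = "fps_X :: int fps fps"
  define C where "C = coloured_families h"
  have C: "C = (\<Union>F\<in>families h. {(T, B). T \<union> B = F})"
    by (auto simp: C_def coloured_families_def)
  have fin_col: "finite {(T, B). T \<union> B = F}" if "F \<in> families h" for F
    by (rule finite_subset[of _ "Pow F \<times> Pow F"]) (use finite_family[OF that] in auto)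
  have finC: "finite C" unfolding C using finite_families fin_col by auto
  have "fps_nth (family_gf (?u + ?v + ?u * ?v)) h =
      (\<Sum>F\<in>families h. \<Sum>(T, B) | T \<union> B = F. ?u ^ card T * ?v ^ card B)"
    unfolding family_gf_def fps_nth_Abs_fps
    by (rule sum.cong[OF refl]) (rule sum_colourings[OF finite_family, symmetric])
  also have "\<dots> = (\<Sum>(T, B)\<in>C. ?u ^ card T * ?v ^ card B)"
    unfolding C by (rule sum.UNION_disjoint[symmetric]) (use finite_families fin_col in auto)
  finally have gf: "fps_nth (family_gf (?u + ?v + ?u * ?v)) h = (\<Sum>(T, B)\<in>C. ?u ^ card T * ?v ^ card B)" .
  have mono: "fps_nth (fps_nth (?u ^ a * ?v ^ b) t2) t1 = (if a = t1 \<and> b = t2 then 1 else 0)" for a b t1 t2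
    by (auto simp: fps_const_power fps_X_power_nth)
  show "fps_nth shape_gf h = fps_nth (family_gf (?u + ?v + ?u * ?v)) h"
  proof (rule fps_ext, rule fps_ext)
    fix t2 t1
    have "fps_nth (fps_nth (fps_nth (family_gf (?u + ?v + ?u * ?v)) h) t2) t1 =
        (\<Sum>p\<in>C. if card (fst p) = t1 \<and> card (snd p) = t2 then 1 else 0)"
      unfolding gf fps_sum_nth by (rule sum.cong[OF refl]) (auto simp: mono simp del: fps_const_power)
    also have "\<dots> = int (card {p \<in> C. card (fst p) = t1 \<and> card (snd p) = t2})"
      by (simp add: sum.If_cases[OF finC] Int_def)
    also have "{p \<in> C. card (fst p) = t1 \<and> card (snd p) = t2} =
        {(T, B) \<in> coloured_families h. card T = t1 \<and> card B = t2}"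
      by (auto simp: C_def)
    finally show "fps_nth (fps_nth (fps_nth shape_gf h) t2) t1 =
        fps_nth (fps_nth (fps_nth (family_gf (?u + ?v + ?u * ?v)) h) t2) t1"
      by (simp add: shape_gf_def num_shapes_eq)
  qed
qed

theorem theorem4:
  fixes u v z G A B C :: fps3
  assumes "u = var_u" and "v = var_v" and "z = var_z" and "G = shape_gf"
    and "A = (u + v + u * v) * (z + 1)"
    and "B = - ((u + v + u * v) * (z + 2) + 1)"
    and "C = (1 + u) * (1 + v) * (1 + z)"
  shows "A * G ^ 2 + B * G + C = 0"
proof -
  let ?w = "fps_const fps_X + fps_X + fps_const fps_X * fps_X :: int fps fps"
  have w: "fps_const ?w = u + v + u * v"
    unfolding assms(1,2) var_u_def var_v_def by simp
  have C: "C = (1 + (u + v + u * v)) * (1 + z)"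
    unfolding assms(7) by (simp add: algebra_simps)
  show ?thesis
    using family_gf_eq[of ?w]
    unfolding w shape_gf_eq_family_gf[symmetric] assms(4)[symmetric] var_z_def[symmetric] assms(3)[symmetric]
      C assms(5,6)
    by (simp only: mult_minus_left add_uminus_conv_diff)
qed

end
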